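(* Let $p>2$ be a prime, let $\overline{\mathbb{F}}_p$ be the algebraic closure of $\mathbb{F}_p$, and let $G=SL(2,\overline{\mathbb{F}}_p)$. Write $G=\bigcup_{n=1}^\infty G_n$ as an increasing union of finite subgroups $G_n=SL(2,\mathbb{F}_{q_n})$, where each $\mathbb{F}_{q_n}\subset\overline{\mathbb{F}}_p$ is a finite extension of $\mathbb{F}_{q_{n-1}}$. Then $G$ with the equipment $\lambda=\{G_n\}$ has a scaling entropy growth gap, with lower bound $\phi(n)=\log(q_n)$: every free p.m.p. action $\alpha$ of $G$ on a Lebesgue space satisfies $\mathcal{H}(\alpha,\lambda)\succsim\phi$.
   Context: An equipment of a countable amenable group $G$ is a Følner sequence $\lambda=\{F_n\}$ in $G$ (here $F_n=G_n$). $(X,\mu)$ denotes a Lebesgue space (standard non-atomic probability space). A p.m.p. action is free if almost every point has trivial stabilizer. $G$ has a scaling entropy growth gap with respect to $\lambda$ if there is a function $\phi(n)\to\infty$ such that $\mathcal{H}(\alpha,\lambda)\succsim\phi$ for every free p.m.p. action $\alpha$ of $G$. Scaling entropy. A measurable semimetric on $(X,\mu)$ is a measurable function $\rho:(X^2,\mu^2)\to[0,\infty)$ that is symmetric and satisfies the triangle inequality. For $\varepsilon>0$, $\mathbb{H}_\varepsilon(X,\mu,\rho)=\log_2 k$, where $k$ is the minimal positive integer such that $X$ is a union of measurable sets $X_0,X_1,\dots,X_k$ with $\mu(X_0)<\varepsilon$ and $\mathrm{diam}_\rho(X_i)<\varepsilon$ for $i=1,\dots,k$ (and $\mathbb{H}_\varepsilon=+\infty$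 if no such $k$ exists). $\rho$ is admissible if it is separable on some subset of full measure (equivalently $\mathbb{H}_\varepsilon(X,\mu,\rho)<\infty$ for all $\varepsilon>0$). $\mathcal{A}dm(X,\mu)$ is the set of admissible semimetrics in $L^1(X^2,\mu^2)$. Given an action $\alpha$ of $G$ on $(X,\mu)$, $\rho$ is generating if its translates $(x,y)\mapsto\rho(gx,gy)$, $g\in G$, together separate points of $X$ up to a null set. Put $G^n_{av}\rho(x,y)=\frac1{|F_n|}\sum_{g\in F_n}\rho(gx,gy)$ and $\Phi_\rho(n,\varepsilon)=\mathbb{H}_\varepsilon(X,\mu,G^n_{av}\rho)$. For sequences, $\phi\precsim\psi$ means $\phi(n)=O(\psi(n))$. For functions $\Phi,\Psi:\mathbb{N}\times\mathbb{R}_+\to\mathbb{R}_+$ decreasing (non-strictly) in the second argument: $\Phi\precsim\Psi$ (also written $\Psi\succsim\Phi$) means that for every $\varepsilon>0$ there is $\delta>0$ with $\Phi(n,\varepsilon)\precsim\Psi(n,\delta)$; $\Phi\asymp\Psi$ means $\Phi\precsim\Psi$ and $\Psi\precsim\Phi$. A sequence $\phi(n)$ is regarded as a function of $(n,\varepsilon)$ not depending on $\varepsilon$; thus $\Psi\succsim\phi$ means $\phi(n)=O(\Psi(n,\delta))$ for some $\delta>0$. The scaling entropy $\mathcal{H}(\alpha,\lambda)$ is the $\asymp$-equivalence class of $\Phi_\rho$ for any generating $\rho\in\mathcal{A}dm(X,\mu)$; by a theorem of Zatitskiy it does not depend on the choice of $\rho$. $\mathcal{H}(\alpha,\lambda)\succsim\phi$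 means $\Phi\succsim\phi$ for (one, equivalently every) $\Phi\in\mathcal{H}(\alpha,\lambda)$. *)

theory Defs
  imports
    "HOL-Analysis.Analysis"
    "HOL-Probability.Probability"
    "HOL-Algebra.Group_Action"
    "HOL-Algebra.Algebraic_Closure_Type"
begin

section \<open>Lebesgue spaces\<close>

text \<open>
  A Lebesgue space in Rokhlin's sense: a complete probability space that is isomorphic modulo
  null sets to the unit interval with Lebesgue measure (hence without atoms).
\<close>

definition lebesgue_space :: "'x measure \<Rightarrow> bool" where
  "lebesgue_space M \<longleftrightarrow>
     prob_space M \<and> complete_measure M \<and>
     (\<exists>A B f h. space M - A \<in> null_sets M \<and> A \<subseteq> space M \<and>
        {0..1::real} - B \<in> null_sets lebesgue \<and> B \<subseteq> {0..1} \<and>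
        f \<in> measurable (restrict_space M A) (lebesgue_on B) \<and>
        h \<in> measurable (lebesgue_on B) (restrict_space M A) \<and>
        (\<forall>x\<in>A. h (f x) = x) \<and> (\<forall>t\<in>B. f (h t) = t) \<and>
        distr (restrict_space M A) (lebesgue_on B) f = lebesgue_on B)"


section \<open>Free probability measure preserving actions\<close>

definition pmp_action :: "('g, 'b) monoid_scheme \<Rightarrow> 'x measure \<Rightarrow> ('g \<Rightarrow> 'x \<Rightarrow> 'x) \<Rightarrow> bool" where
  "pmp_action G M \<alpha> \<longleftrightarrow>
     group_action G (space M) \<alpha> \<and>
     (\<forall>g\<in>carrier G. \<alpha> g \<in> measurable M M \<and> distr M M (\<alpha> g) = M)"

definition free_action :: "('g, 'b) monoid_scheme \<Rightarrow> 'x measure \<Rightarrow> ('g \<Rightarrow> 'x \<Rightarrow> 'x) \<Rightarrow> bool" where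
  "free_action G M \<alpha> \<longleftrightarrow> (AE x in M. stabilizer G \<alpha> x = {\<one>\<^bsub>G\<^esub>})"


section \<open>Equipments\<close>

text \<open>
  The translates are taken on the right because replacing \<open>\<rho>(x, y)\<close> by \<open>\<rho>(h x, h y)\<close> turns an
  average over \<open>F n\<close> into an average over \<open>F n h\<close>.
\<close>

definition folner_sequence :: "('g, 'b) monoid_scheme \<Rightarrow> (nat \<Rightarrow> 'g set) \<Rightarrow> bool" where
  "folner_sequence G F \<longleftrightarrow>
     (\<forall>n. finite (F n) \<and> F n \<noteq> {} \<and> F n \<subseteq> carrier G) \<and>
     (\<forall>g\<in>carrier G.
        (\<lambda>n. real (card (sym_diff (F n #>\<^bsub>G\<^esub> g) (F n))) / real (card (F n))) \<longlonglongrightarrow> 0)"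


section \<open>Semimetrics and their epsilon-entropy\<close>

text \<open>
  Measurability of functions on \<open>X\<^sup>2\<close> refers to the completion of the product measure, which is the
  product in the category of Lebesgue spaces.  Vanishing on the diagonal is not required; for
  admissible \<open>\<rho>\<close> it follows at almost every point.
\<close>

definition measurable_semimetric :: "'x measure \<Rightarrow> ('x \<Rightarrow> 'x \<Rightarrow> real) \<Rightarrow> bool" where
  "measurable_semimetric M \<rho> \<longleftrightarrow>
     (\<lambda>(x, y). \<rho> x y) \<in> borel_measurable (completion (M \<Otimes>\<^sub>M M)) \<and>
     (\<forall>x\<in>space M. \<forall>y\<in>space M. 0 \<le> \<rho> x y \<and> \<rho> x y = \<rho> y x) \<and>
     (\<forall>x\<in>space M. \<forall>y\<in>space M. \<forall>z\<in>space M. \<rho> x z \<le> \<rho> x y + \<rho> y z)"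

definition separable_on :: "'x set \<Rightarrow> ('x \<Rightarrow> 'x \<Rightarrow> real) \<Rightarrow> bool" where
  "separable_on A \<rho> \<longleftrightarrow>
     (\<exists>D. countable D \<and> D \<subseteq> A \<and> (\<forall>x\<in>A. \<forall>e>0. \<exists>d\<in>D. \<rho> x d < e))"

text \<open>The set \<open>Adm(X, \<mu>)\<close> of admissible semimetrics in \<open>L\<^sup>1(X\<^sup>2, \<mu>\<^sup>2)\<close>.\<close>

definition admissible_semimetrics :: "'x measure \<Rightarrow> ('x \<Rightarrow> 'x \<Rightarrow> real) set" where
  "admissible_semimetrics M =
     {\<rho>. measurable_semimetric M \<rho> \<and>
         integrable (completion (M \<Otimes>\<^sub>M M)) (\<lambda>(x, y). \<rho> x y) \<and>
         (\<exists>A. A \<subseteq> space M \<and> space M - A \<in> null_sets M \<and> separable_on A \<rho>)}"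

definition generating ::
  "('g, 'b) monoid_scheme \<Rightarrow> 'x measure \<Rightarrow> ('g \<Rightarrow> 'x \<Rightarrow> 'x) \<Rightarrow> ('x \<Rightarrow> 'x \<Rightarrow> real) \<Rightarrow> bool" where
  "generating G M \<alpha> \<rho> \<longleftrightarrow>
     (\<exists>A. A \<subseteq> space M \<and> space M - A \<in> null_sets M \<and>
        (\<forall>x\<in>A. \<forall>y\<in>A. x \<noteq> y \<longrightarrow> (\<exists>g\<in>carrier G. \<rho> (\<alpha> g x) (\<alpha> g y) > 0)))"

text \<open>The value on the empty set is \<open>-\<infinity>\<close>, which is harmless in conditions of the form \<open>diam A < \<epsilon>\<close>.\<close>

definition semimetric_diam :: "('x \<Rightarrow> 'x \<Rightarrow> real) \<Rightarrow> 'x set \<Rightarrow> ereal" where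
  "semimetric_diam \<rho> A = (SUP (x, y)\<in>A \<times> A. ereal (\<rho> x y))"

definition entropy_partition ::
  "'x measure \<Rightarrow> ('x \<Rightarrow> 'x \<Rightarrow> real) \<Rightarrow> real \<Rightarrow> nat \<Rightarrow> bool" where
  "entropy_partition M \<rho> \<epsilon> k \<longleftrightarrow>
     (\<exists>S :: nat \<Rightarrow> 'x set. (\<forall>i\<le>k. S i \<in> sets M) \<and> space M = (\<Union>i\<le>k. S i) \<and>
        measure M (S 0) < \<epsilon> \<and> (\<forall>i\<in>{1..k}. semimetric_diam \<rho> (S i) < ereal \<epsilon>))"

text \<open>The infimum is attained at the least admissible \<open>k\<close>; it is \<open>\<infinity>\<close> if there is none.\<close>

definition eps_entropy :: "'x measure \<Rightarrow> ('x \<Rightarrow> 'x \<Rightarrow> real) \<Rightarrow> real \<Rightarrow> ereal" where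
  "eps_entropy M \<rho> \<epsilon> = (INF k\<in>{k. 1 \<le> k \<and> entropy_partition M \<rho> \<epsilon> k}. ereal (log 2 (real k)))"


section \<open>Scaling entropy\<close>

definition averaged_semimetric ::
  "('g \<Rightarrow> 'x \<Rightarrow> 'x) \<Rightarrow> 'g set \<Rightarrow> ('x \<Rightarrow> 'x \<Rightarrow> real) \<Rightarrow> 'x \<Rightarrow> 'x \<Rightarrow> real" where
  "averaged_semimetric \<alpha> F \<rho> = (\<lambda>x y. (\<Sum>g\<in>F. \<rho> (\<alpha> g x) (\<alpha> g y)) / real (card F))"

definition entropy_function ::
  "'x measure \<Rightarrow> ('g \<Rightarrow> 'x \<Rightarrow> 'x) \<Rightarrow> (nat \<Rightarrow> 'g set) \<Rightarrow> ('x \<Rightarrow> 'x \<Rightarrow> real) \<Rightarrow> nat \<Rightarrow> real \<Rightarrow> ereal" where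
  "entropy_function M \<alpha> F \<rho> n \<epsilon> = eps_entropy M (averaged_semimetric \<alpha> (F n) \<rho>) \<epsilon>"

text \<open>
  The relation \<open>\<phi>(n) = O(\<psi>(n))\<close> for nonnegative sequences; Landau symbols are not available for
  extended reals, which are used because \<open>\<epsilon>\<close>-entropies are a priori extended numbers.
\<close>

definition seq_precsim :: "(nat \<Rightarrow> ereal) \<Rightarrow> (nat \<Rightarrow> ereal) \<Rightarrow> bool" where
  "seq_precsim \<phi> \<psi> \<longleftrightarrow> (\<exists>C>0. \<forall>\<^sub>F n in sequentially. \<phi> n \<le> ereal C * \<psi> n)"

definition precsim :: "(nat \<Rightarrow> real \<Rightarrow> ereal) \<Rightarrow> (nat \<Rightarrow> real \<Rightarrow> ereal) \<Rightarrow> bool"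
    (infix "\<lesssim>" 50) where
  "\<Phi> \<lesssim> \<Psi> \<longleftrightarrow> (\<forall>\<epsilon>>0. \<exists>\<delta>>0. seq_precsim (\<lambda>n. \<Phi> n \<epsilon>) (\<lambda>n. \<Psi> n \<delta>))"

text \<open>
  The scaling entropy is the class of \<open>\<Phi>\<^sub>\<rho>\<close> for any generating \<open>\<rho>\<close>.  Since it is independent of
  \<open>\<rho>\<close>, it is written as the union over all such \<open>\<rho>\<close>, so that a bound for all its members is a bound
  for every choice of \<open>\<rho>\<close>.
\<close>

definition scaling_entropy ::
  "('g, 'b) monoid_scheme \<Rightarrow> 'x measure \<Rightarrow> ('g \<Rightarrow> 'x \<Rightarrow> 'x) \<Rightarrow> (nat \<Rightarrow> 'g set) \<Rightarrow>
     (nat \<Rightarrow> real \<Rightarrow> ereal) set" where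
  "scaling_entropy G M \<alpha> F =
     {\<Phi>. (\<forall>n. \<forall>\<epsilon>>0. 0 \<le> \<Phi> n \<epsilon>) \<and> (\<forall>n. antimono_on {0<..} (\<Phi> n)) \<and>
         (\<exists>\<rho>\<in>admissible_semimetrics M. generating G M \<alpha> \<rho> \<and>
            \<Phi> \<lesssim> entropy_function M \<alpha> F \<rho> \<and> entropy_function M \<alpha> F \<rho> \<lesssim> \<Phi>)}"

text \<open>
  The sequence \<open>\<phi>\<close> witnesses that \<open>G\<close> has a scaling entropy growth gap with respect to \<open>F\<close>.  The
  type argument is the type of points of the underlying spaces, over which a definition cannot
  quantify.
\<close>

definition scaling_entropy_growth_gap ::
  "'x itself \<Rightarrow> ('g, 'b) monoid_scheme \<Rightarrow> (nat \<Rightarrow> 'g set) \<Rightarrow> (nat \<Rightarrow> real) \<Rightarrow> bool" where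
  "scaling_entropy_growth_gap _ G F \<phi> \<longleftrightarrow>
     filterlim \<phi> at_top sequentially \<and>
     (\<forall>(M :: 'x measure) \<alpha>.
        lebesgue_space M \<and> pmp_action G M \<alpha> \<and> free_action G M \<alpha> \<longrightarrow>
        (\<forall>\<Phi>\<in>scaling_entropy G M \<alpha> F. (\<lambda>n \<epsilon>. ereal (\<phi> n)) \<lesssim> \<Phi>))"


section \<open>The group SL(2)\<close>

text \<open>This is the group \<open>SL(2, K)\<close> when \<open>K\<close> is a subfield of the ambient field.\<close>

definition SL2 :: "'k::comm_ring_1 set \<Rightarrow> ('k ^ 2 ^ 2) monoid" where
  "SL2 K = \<lparr>carrier = {A. det A = 1 \<and> (\<forall>i j. A $ i $ j \<in> K)}, monoid.mult = (**), one = mat 1\<rparr>"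

end

theory Submission
  imports Defs
begin

text \<open>
  Let \<open>r = min 1 \<rho>\<close>, let \<open>r\<^sub>n\<close> be its average over \<open>G\<^sub>n = SL(2, q)\<close>, which is
  \<open>G\<^sub>n\<close>-invariant, and suppose that \<open>k\<close> sets of \<open>r\<^sub>n\<close>-diameter less than \<open>\<delta>\<close> cover \<open>X\<close> up
  to measure \<open>\<delta>\<close>, where \<open>16 k\<^sup>3 + 1 < q\<close>.  For most \<open>x\<close>, the pigeonhole principle on the orbits
  of \<open>x\<close> under the upper and lower unipotent subgroups and under the torus yields dense sets \<open>B\<close>,
  \<open>B'\<close> and \<open>E\<close> of parameters such that the length function \<open>g \<mapsto> r\<^sub>n(x, g x)\<close> is at most \<open>\<delta>\<close> on
  upper (lower) unipotents with parameter in \<open>B - B\<close> (in \<open>B' - B'\<close>) and on torus elements with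
  parameter in \<open>E / E\<close>.  A count of collisions gives \<open>e \<in> E / E\<close> with
  \<open>(B - B) + e\<^sup>2 (B - B) = F\<^sub>q\<close>, and likewise for \<open>B'\<close>.  Conjugation by the torus dilates
  unipotents by \<open>e\<^sup>2\<close>, so every upper or lower unipotent has length at most \<open>4 \<delta>\<close> and every
  element of \<open>G\<^sub>n\<close>, a product of four of them, length at most \<open>16 \<delta>\<close>.

  Integration over \<open>x\<close> bounds the mean over \<open>G\<^sub>n\<close> of the displacement \<open>\<integral> r(x, g x) d\<mu>\<close>, hence
  the displacement of each \<open>g \<in> G\<^sub>n\<close>, by a multiple of \<open>\<delta>\<close>.  If the entropy were not bounded
  below by a multiple of \<open>log q\<^sub>n\<close> for any \<open>\<delta>\<close>, all displacements would vanish, and a generating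
  \<open>\<rho>\<close> would force every \<open>g\<close> to fix almost every point.
\<close>

section \<open>Sums of dilates in a finite field\<close>

text \<open>Closure conditions on a subset of a type class field keep the arithmetic of the type
  available; \<open>inverse_K\<close> may include zero because \<open>inverse 0 = 0\<close>.\<close>

locale finite_subfield =
  fixes K :: "'k::field set"
  assumes finite_K: "finite K" and zero_K: "0 \<in> K" and one_K: "1 \<in> K"
    and add_K: "\<And>a b. a \<in> K \<Longrightarrow> b \<in> K \<Longrightarrow> a + b \<in> K"
    and uminus_K: "\<And>a. a \<in> K \<Longrightarrow> - a \<in> K"
    and mult_K: "\<And>a b. a \<in> K \<Longrightarrow> b \<in> K \<Longrightarrow> a * b \<in> K"
    and inverse_K: "\<And>a. a \<in> K \<Longrightarrow> inverse a \<in> K"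
begin

lemma diff_K: "a \<in> K \<Longrightarrow> b \<in> K \<Longrightarrow> a - b \<in> K"
  using add_K[of a "- b"] uminus_K[of b] by simp

lemma divide_K: "a \<in> K \<Longrightarrow> b \<in> K \<Longrightarrow> a / b \<in> K"
  using mult_K[of a "inverse b"] inverse_K[of b] by (simp add: divide_inverse)

end

lemma finite_subfieldI:
  assumes "subfield K (ring_of_type_algebra :: 'k::field ring)" and "finite K"
  shows "finite_subfield K"
proof -
  let ?R = "ring_of_type_algebra :: 'k ring"
  interpret R: field ?R by (rule field_from_type_algebra)
  have sub: "subring K ?R" using subfieldE(1)[OF assms(1)] .
  have simps: "carrier ?R = UNIV" "zero ?R = 0" "one ?R = 1"
    "\<And>a b. a \<oplus>\<^bsub>?R\<^esub> b = a + b" "\<And>a b. a \<otimes>\<^bsub>?R\<^esub> b = a * b"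
    by (simp_all add: ring_of_type_algebra_def)
  have neg: "\<ominus>\<^bsub>?R\<^esub> a = - a" for a
    using R.minus_equality[of "- a" a] by (simp add: simps)
  have inv: "inv\<^bsub>?R\<^esub> a = inverse a" if "a \<noteq> 0" for a
    using R.comm_inv_char[of a "inverse a"] that by (simp add: simps)
  have inverse_K: "inverse a \<in> K" if "a \<in> K" for a
  proof (cases "a = 0")
    case True
    then show ?thesis using that by simp
  next
    case False
    then show ?thesis using R.subfield_m_inv(1)[OF assms(1), of a] that by (simp add: inv simps)
  qed
  show ?thesis
    using subringE[OF sub] assms(2) inverse_K by unfold_locales (auto simp: simps neg)
qed

text \<open>Cauchy-Schwarz over the fibres of \<open>f\<close>: their sizes sum to
  \<open>card P\<close>, and the squares of the sizes sum to the number of collisions.\<close>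

lemma card_sq_le_card_image_mult_collisions:
  assumes "finite P"
  shows "(card P)\<^sup>2 \<le> card (f ` P) * card {(p, p') \<in> P \<times> P. f p = f p'}"
proof -
  let ?F = "\<lambda>z. {p \<in> P. f p = z}"
  have fin: "finite (f ` P)" using assms by simp
  have "card P = card (\<Union>z\<in>f ` P. ?F z)" by (rule arg_cong[where f = card]) auto
  also have "\<dots> = (\<Sum>z\<in>f ` P. card (?F z))"
    using assms by (subst card_UN_disjoint) auto
  finally have P: "card P = (\<Sum>z\<in>f ` P. card (?F z))" .
  have "{(p, p') \<in> P \<times> P. f p = f p'} = (\<Union>z\<in>f ` P. ?F z \<times> ?F z)" by auto
  also have "card \<dots> = (\<Sum>z\<in>f ` P. card (?F z \<times> ?F z))"
    using assms by (subst card_UN_disjoint) auto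
  finally have E: "card {(p, p') \<in> P \<times> P. f p = f p'} = (\<Sum>z\<in>f ` P. (card (?F z))\<^sup>2)"
    by (simp add: card_cartesian_product power2_eq_square)
  have "(\<Sum>z\<in>f ` P. real (card (?F z)))\<^sup>2 \<le> (\<Sum>z\<in>f ` P. (real (card (?F z)))\<^sup>2) * card (f ` P)"
    by (rule sum_squared_le_sum_of_squares)
  then have "real ((\<Sum>z\<in>f ` P. card (?F z))\<^sup>2) \<le> real ((\<Sum>z\<in>f ` P. (card (?F z))\<^sup>2) * card (f ` P))"
    by simp
  then show ?thesis unfolding E by (subst P) (simp only: of_nat_le_iff mult.commute)
qed

section \<open>Covering a finite field by a difference set and a dilate of it\<close>

context finite_subfield
begin

lemma card_K_pos: "card K > 0"
  using finite_K zero_K by (auto simp: card_gt_0_iff)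

text \<open>
  A pair of distinct second coordinates determines the dilation under which two given points of
  \<open>B \<times> B\<close> collide, so the expected number of collisions is almost the least possible one.
\<close>

lemma sum_collisions_le:
  assumes "B \<subseteq> K"
  shows "(\<Sum>s\<in>K. card {(p, p') \<in> (B \<times> B) \<times> (B \<times> B). fst p + s * snd p = fst p' + s * snd p'})
    \<le> card K * (card B)\<^sup>2 + card B ^ 4"
proof -
  have finB: "finite B" using assms finite_K finite_subset by auto
  let ?Q = "(B \<times> B) \<times> (B \<times> B)"
  let ?coll = "\<lambda>s (p, p'). fst p + s * snd p = fst p' + s * snd p'"
  let ?D = "{(p, p') \<in> ?Q. p = p'}"
  have le: "card {s \<in> K. ?coll s w} \<le> (if w \<in> ?D then card K else 0) + 1" if w: "w \<in> ?Q" for w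
  proof -
    obtain x y x' y' where w': "w = ((x, y), (x', y'))" by (metis prod.collapse)
    show ?thesis
    proof (cases "w \<in> ?D")
      case True
      then show ?thesis using card_mono[OF finite_K, of "{s \<in> K. ?coll s w}"] by auto
    next
      case False
      have "{s \<in> K. ?coll s w} \<subseteq> {(x' - x) / (y - y')}"
      proof
        fix s assume "s \<in> {s \<in> K. ?coll s w}"
        then have eq: "x + s * y = x' + s * y'" by (simp add: w')
        with False w have "y \<noteq> y'" by (auto simp: w')
        moreover have "s * (y - y') = x' - x" using eq by (simp add: algebra_simps)
        ultimately show "s \<in> {(x' - x) / (y - y')}" by (simp add: field_simps)
      qed
      from card_mono[OF _ this] False show ?thesis by auto
    qed
  qed
  have "(\<Sum>s\<in>K. card {w \<in> ?Q. ?coll s w}) = (\<Sum>w\<in>?Q. card {s \<in> K. ?coll s w})"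
  proof -
    have "(\<Sum>s\<in>K. card {w \<in> ?Q. ?coll s w}) = (\<Sum>s\<in>K. \<Sum>w\<in>?Q. if ?coll s w then 1 else 0)"
      using finB by (intro sum.cong refl) (simp add: sum.If_cases Int_def)
    also have "\<dots> = (\<Sum>w\<in>?Q. \<Sum>s\<in>K. if ?coll s w then 1 else 0)" by (rule sum.swap)
    also have "\<dots> = (\<Sum>w\<in>?Q. card {s \<in> K. ?coll s w})"
      using finite_K by (intro sum.cong refl) (simp add: sum.If_cases Int_def)
    finally show ?thesis .
  qed
  also have "\<dots> \<le> (\<Sum>w\<in>?Q. (if w \<in> ?D then card K else 0) + 1)" by (rule sum_mono[OF le])
  also have "\<dots> = card K * card ?D + card ?Q"
  proof -
    have "?Q \<inter> ?D = ?D" by auto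
    then show ?thesis
      using finB unfolding sum.distrib
      by (subst sum.inter_restrict[symmetric]) auto
  qed
  also have "card ?D = (card B)\<^sup>2"
  proof -
    have "?D = (\<lambda>p. (p, p)) ` (B \<times> B)" by auto
    then show ?thesis by (simp add: card_image inj_on_def card_cartesian_product power2_eq_square)
  qed
  also have "card ?Q = card B ^ 4"
    by (simp add: card_cartesian_product power4_eq_xxxx)
  finally show ?thesis by (simp add: case_prod_unfold mem_Times_iff conj_assoc)
qed

text \<open>Small images force collisions: if \<open>B + s B\<close> had at most half of the
  elements of \<open>K\<close> for every \<open>s\<close> in \<open>S\<close>, the total would
  exceed the bound of \<open>sum_collisions_le\<close>. A set with more than half of the elements
  meets all its translates, so its differences exhaust \<open>K\<close>.\<close>

lemma diff_set_plus_dilate_eq: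
  assumes B: "B \<subseteq> K" and S: "S \<subseteq> K" and large: "(card K)\<^sup>2 < card S * (card B)\<^sup>2"
  shows "\<exists>s\<in>S. \<forall>t\<in>K. \<exists>b1\<in>B. \<exists>b2\<in>B. \<exists>b3\<in>B. \<exists>b4\<in>B. t = (b1 - b2) + s * (b3 - b4)"
proof -
  have finB: "finite B" and finS: "finite S" using B S finite_K finite_subset by auto
  define q b where "q = real (card K)" and "b = real (card B)"
  have q: "q > 0" using card_K_pos by (simp add: q_def)
  define f where "f s p = fst p + s * snd p" for s and p :: "'k \<times> 'k"
  define E where "E s = card {(p, p') \<in> (B \<times> B) \<times> (B \<times> B). f s p = f s p'}" for s
  have b: "b > 0" using large by (cases "card B = 0") (auto simp: b_def)
  have fK: "f s ` (B \<times> B) \<subseteq> K" if "s \<in> K" for s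
    using that B by (auto simp: f_def intro!: add_K mult_K)
  have E: "b ^ 4 \<le> real (card (f s ` (B \<times> B))) * E s" for s
  proof -
    have "(card (B \<times> B))\<^sup>2 \<le> card (f s ` (B \<times> B)) * E s"
      unfolding E_def by (rule card_sq_le_card_image_mult_collisions) (use finB in simp)
    then have "real ((card (B \<times> B))\<^sup>2) \<le> real (card (f s ` (B \<times> B)) * E s)" by (rule of_nat_mono)
    then show ?thesis by (simp add: card_cartesian_product b_def power4_eq_xxxx power2_eq_square)
  qed
  have E1: "b ^ 4 / q \<le> E s" if "s \<in> K" for s
  proof -
    have "real (card (f s ` (B \<times> B))) * E s \<le> q * E s"
      using card_mono[OF finite_K fK[OF that]] by (intro mult_right_mono) (auto simp: q_def)
    with E[of s] q show ?thesis by (simp add: field_simps)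
  qed
  have sumE: "(\<Sum>s\<in>K. real (E s)) \<le> q * b\<^sup>2 + b ^ 4"
  proof -
    have "real (\<Sum>s\<in>K. E s) \<le> real (card K * (card B)\<^sup>2 + card B ^ 4)"
      using sum_collisions_le[OF B] unfolding E_def f_def by (rule of_nat_mono)
    then show ?thesis by (simp add: q_def b_def)
  qed
  have "\<exists>s\<in>S. real (card (f s ` (B \<times> B))) > q / 2"
  proof (rule ccontr)
    assume "\<not> ?thesis"
    then have small: "real (card (f s ` (B \<times> B))) \<le> q / 2" if "s \<in> S" for s using that by force
    \<comment> \<open>An image of at most \<open>q / 2\<close> points doubles the number of
      collisions that \<open>E1\<close> forces for every dilation.\<close>
    have E2: "2 * (b ^ 4 / q) \<le> E s" if "s \<in> S" for s
    proof -
      have "real (card (f s ` (B \<times> B))) * E s \<le> q / 2 * E s"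
        using small[OF that] by (intro mult_right_mono) auto
      with E[of s] q show ?thesis by (simp add: field_simps)
    qed
    \<comment> \<open>The first sum is \<open>b ^ 4\<close> and cancels against \<open>sumE\<close>;
      what is left compares the surplus from \<open>S\<close> with the diagonal collisions
      \<open>q * b\<^sup>2\<close>.\<close>
    have "(\<Sum>s\<in>K. b ^ 4 / q) + (\<Sum>s\<in>S. b ^ 4 / q) = (\<Sum>s\<in>K - S. b ^ 4 / q) + (\<Sum>s\<in>S. 2 * (b ^ 4 / q))"
      using sum.subset_diff[OF S finite_K, of "\<lambda>_. b ^ 4 / q"] by (simp add: sum_distrib_left[symmetric])
    also have "\<dots> \<le> (\<Sum>s\<in>K - S. real (E s)) + (\<Sum>s\<in>S. real (E s))"
      by (intro add_mono sum_mono E1 E2) auto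
    also have "\<dots> = (\<Sum>s\<in>K. real (E s))" using sum.subset_diff[OF S finite_K] by metis
    also have "\<dots> \<le> q * b\<^sup>2 + b ^ 4" by (rule sumE)
    finally have "real (card S) * (b ^ 4 / q) \<le> q * b\<^sup>2" using q by (simp add: q_def[symmetric])
    then have "(real (card S) * b\<^sup>2) * b\<^sup>2 \<le> q\<^sup>2 * b\<^sup>2"
      using q by (simp add: field_simps power2_eq_square power4_eq_xxxx)
    then have "real (card S) * b\<^sup>2 \<le> q\<^sup>2" using b by simp
    then have "real (card S * (card B)\<^sup>2) \<le> real ((card K)\<^sup>2)" by (simp add: q_def b_def)
    with large show False by linarith
  qed
  then obtain s where s: "s \<in> S" "real (card (f s ` (B \<times> B))) > q / 2" by blast
  let ?Z = "f s ` (B \<times> B)"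
  have sK: "s \<in> K" using s S by auto
  have "\<exists>b1\<in>B. \<exists>b2\<in>B. \<exists>b3\<in>B. \<exists>b4\<in>B. t = (b1 - b2) + s * (b3 - b4)" if t: "t \<in> K" for t
  proof -
    have "?Z \<inter> (+) t ` ?Z \<noteq> {}"
    proof
      assume "?Z \<inter> (+) t ` ?Z = {}"
      then have "card (?Z \<union> (+) t ` ?Z) = card ?Z + card ((+) t ` ?Z)"
        using finB by (intro card_Un_disjoint) auto
      also have "card ((+) t ` ?Z) = card ?Z" by (rule card_image) simp
      finally have "card ?Z + card ?Z = card (?Z \<union> (+) t ` ?Z)" by simp
      also have "\<dots> \<le> card K"
        using fK[OF sK] t add_K by (intro card_mono finite_K) blast
      finally show False using s(2) by (simp add: q_def)
    qed
    then obtain p p' where "p \<in> B \<times> B" "p' \<in> B \<times> B" "f s p = t + f s p'" by auto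
    then show ?thesis
      by (intro bexI[of _ "fst p"] bexI[of _ "fst p'"] bexI[of _ "snd p"] bexI[of _ "snd p'"])
         (auto simp: f_def algebra_simps)
  qed
  with s(1) show ?thesis by blast
qed

end


section \<open>Length functions on SL(2)\<close>

definition mat2 :: "'k \<Rightarrow> 'k \<Rightarrow> 'k \<Rightarrow> 'k \<Rightarrow> 'k::comm_ring_1 ^ 2 ^ 2" where
  "mat2 a b c d = vector [vector [a, b], vector [c, d]]"

lemma mat2_mult:
  "mat2 a b c d ** mat2 a' b' c' d' =
     mat2 (a * a' + b * c') (a * b' + b * d') (c * a' + d * c') (c * b' + d * d')"
  by (simp add: mat2_def matrix_matrix_mult_def vec_eq_iff forall_2 sum_2)

lemma mat2_eta: "A = mat2 (A $ 1 $ 1) (A $ 1 $ 2) (A $ 2 $ 1) (A $ 2 $ 2)"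
  by (simp add: mat2_def vec_eq_iff forall_2)

lemma mat2_inject: "mat2 a b c d = mat2 a' b' c' d' \<longleftrightarrow> a = a' \<and> b = b' \<and> c = c' \<and> d = d'"
  by (simp add: mat2_def vec_eq_iff forall_2)

lemma mat_1_eq_mat2: "mat 1 = mat2 1 0 0 1"
  by (simp add: mat2_def mat_def vec_eq_iff forall_2)

lemma mult_SL2: "A \<otimes>\<^bsub>SL2 K\<^esub> B = A ** B"
  by (simp add: SL2_def)

lemma one_SL2: "\<one>\<^bsub>SL2 K\<^esub> = mat 1"
  by (simp add: SL2_def)

lemma mat2_in_SL2_iff:
  "mat2 a b c d \<in> carrier (SL2 K) \<longleftrightarrow> a * d - b * c = 1 \<and> a \<in> K \<and> b \<in> K \<and> c \<in> K \<and> d \<in> K"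
  by (auto simp: SL2_def mat2_def det_2 forall_2)

lemma SL2E:
  assumes "A \<in> carrier (SL2 K)"
  obtains a b c d where "A = mat2 a b c d" "a * d - b * c = 1" "a \<in> K" "b \<in> K" "c \<in> K" "d \<in> K"
  using assms mat2_eta[of A] mat2_in_SL2_iff by metis

lemma finite_carrier_SL2:
  assumes "finite K"
  shows "finite (carrier (SL2 K))"
proof (rule finite_subset)
  show "carrier (SL2 K) \<subseteq> (\<lambda>(a, b, c, d). mat2 a b c d) ` (K \<times> K \<times> K \<times> K)"
  proof
    fix A assume "A \<in> carrier (SL2 K)"
    then obtain a b c d where "A = mat2 a b c d" "a \<in> K" "b \<in> K" "c \<in> K" "d \<in> K"
      by (rule SL2E)
    then show "A \<in> (\<lambda>(a, b, c, d). mat2 a b c d) ` (K \<times> K \<times> K \<times> K)"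
      by (intro image_eqI[of _ _ "(a, b, c, d)"]) auto
  qed
  show "finite ((\<lambda>(a, b, c, d). mat2 a b c d) ` (K \<times> K \<times> K \<times> K))" using assms by simp
qed

lemma group_SL2: "group (SL2 (UNIV :: 'k::field set))"
proof (rule groupI)
  fix A assume "A \<in> carrier (SL2 (UNIV :: 'k set))"
  then obtain a b c d where A: "A = mat2 a b c d" "a * d - b * c = 1" by (rule SL2E)
  then have "mat2 d (- b) (- c) a \<otimes>\<^bsub>SL2 UNIV\<^esub> A = \<one>\<^bsub>SL2 UNIV\<^esub>"
    by (simp add: mult_SL2 one_SL2 mat_1_eq_mat2 mat2_mult mat2_inject algebra_simps)
  then show "\<exists>B\<in>carrier (SL2 UNIV). B \<otimes>\<^bsub>SL2 UNIV\<^esub> A = \<one>\<^bsub>SL2 UNIV\<^esub>"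
    using A(2) by (intro bexI[of _ "mat2 d (- b) (- c) a"]) (auto simp: mat2_in_SL2_iff algebra_simps)
qed (auto simp: SL2_def det_mul matrix_mul_assoc)

text \<open>An element of an integral domain has at most two square roots. Dilations by squares thus
  lose only a factor two against the torus parameters that produce them.\<close>

lemma card_le_card_squares:
  fixes E :: "'k::idom set"
  assumes "finite E"
  shows "card E \<le> 2 * card ((\<lambda>x. x\<^sup>2) ` E)"
proof -
  let ?S = "(\<lambda>x. x\<^sup>2) ` E"
  have "card E = card (\<Union>z\<in>?S. {x \<in> E. x\<^sup>2 = z})" by (rule arg_cong[where f = card]) auto
  also have "\<dots> \<le> (\<Sum>z\<in>?S. card {x \<in> E. x\<^sup>2 = z})" using assms by (intro card_UN_le) simp
  also have "\<dots> \<le> (\<Sum>z\<in>?S. 2)"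
  proof (rule sum_mono)
    fix z assume "z \<in> ?S"
    then obtain y where "z = y\<^sup>2" by auto
    then have "{x \<in> E. x\<^sup>2 = z} \<subseteq> {y, - y}" by (auto simp: power2_eq_iff)
    from card_mono[OF _ this] show "card {x \<in> E. x\<^sup>2 = z} \<le> 2"
      using card_insert_le_m1[of 2 "{- y}" y] by simp
  qed
  finally show ?thesis by simp
qed

text \<open>The middle factor supplies the entry \<open>c\<close>, the outer two correct the
  diagonal, and for nonzero \<open>c\<close> the determinant then forces \<open>b\<close>.\<close>

lemma mat2_eq_transvections:
  fixes a :: "'k::field"
  assumes "a * d - b * c = 1" and "c \<noteq> 0"
  shows "mat2 1 ((a - 1) / c) 0 1 ** (mat2 1 0 c 1 ** mat2 1 ((d - 1) / c) 0 1) = mat2 a b c d"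
proof -
  have "a * d = 1 + b * c" using assms(1) by (simp add: algebra_simps)
  then show ?thesis using assms(2) by (simp add: mat2_mult mat2_inject field_simps)
qed

section \<open>Subgroups over a finite subfield and length functions on them\<close>

context finite_subfield
begin

lemma subgroup_SL2: "subgroup (carrier (SL2 K)) (SL2 (UNIV :: 'k set))"
proof -
  interpret group "SL2 (UNIV :: 'k set)" by (rule group_SL2)
  show ?thesis
  proof (rule subgroupI)
    show "carrier (SL2 K) \<subseteq> carrier (SL2 UNIV)" by (auto simp: SL2_def)
    have "mat2 1 0 0 1 \<in> carrier (SL2 K)" by (simp add: mat2_in_SL2_iff zero_K one_K)
    then show "carrier (SL2 K) \<noteq> {}" by auto
  next
    fix A B assume "A \<in> carrier (SL2 K)" "B \<in> carrier (SL2 K)"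
    moreover from this have "(A ** B) $ i $ j \<in> K" for i j
      by (simp add: SL2_def matrix_matrix_mult_def sum_2 add_K mult_K)
    ultimately show "A \<otimes>\<^bsub>SL2 UNIV\<^esub> B \<in> carrier (SL2 K)" by (simp add: SL2_def det_mul)
  next
    fix A assume "A \<in> carrier (SL2 K)"
    then obtain a b c d where A: "A = mat2 a b c d" "a * d - b * c = 1"
      "a \<in> K" "b \<in> K" "c \<in> K" "d \<in> K" by (rule SL2E)
    have "mat2 d (- b) (- c) a \<otimes>\<^bsub>SL2 UNIV\<^esub> A = \<one>\<^bsub>SL2 UNIV\<^esub>"
      using A(2) by (simp add: A(1) mult_SL2 one_SL2 mat_1_eq_mat2 mat2_mult mat2_inject algebra_simps)
    then have "inv\<^bsub>SL2 UNIV\<^esub> A = mat2 d (- b) (- c) a"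
      using A by (intro inv_equality) (auto simp: mat2_in_SL2_iff algebra_simps)
    then show "inv\<^bsub>SL2 UNIV\<^esub> A \<in> carrier (SL2 K)"
      using A by (simp add: mat2_in_SL2_iff uminus_K algebra_simps)
  qed
qed

text \<open>Left multiplication by a lower unipotent with parameter \<open>r\<close> replaces
  \<open>c\<close> by \<open>c + r * a\<close>. If \<open>c = 0\<close> then \<open>a\<close> is
  nonzero and \<open>r = 1\<close> makes this entry nonzero; otherwise \<open>r = 0\<close> does.
  The factor with parameter \<open>- r\<close> undoes the change.\<close>

lemma SL2_transvections:
  assumes "A \<in> carrier (SL2 K)"
  obtains s t u v where "s \<in> K" "t \<in> K" "u \<in> K" "v \<in> K"
    "A = mat2 1 0 s 1 ** (mat2 1 t 0 1 ** (mat2 1 0 u 1 ** mat2 1 v 0 1))"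
proof -
  obtain a b c d where A: "A = mat2 a b c d" "a * d - b * c = 1"
    "a \<in> K" "b \<in> K" "c \<in> K" "d \<in> K" using assms by (rule SL2E)
  note transv = that
  have *: thesis if r: "r \<in> K" "c + r * a \<noteq> 0" for r
  proof -
    let ?c = "c + r * a" and ?d = "d + r * b"
    have K:  "- r \<in> K" "(a - 1) / ?c \<in> K" "?c \<in> K" "(?d - 1) / ?c \<in> K"
      using A r one_K by (auto intro!: uminus_K divide_K diff_K add_K mult_K)
    have "a * ?d - b * ?c = 1" using A(2) by (simp add: algebra_simps)
    then have eq: "mat2 1 ((a - 1) / ?c) 0 1 ** (mat2 1 0 ?c 1 ** mat2 1 ((?d - 1) / ?c) 0 1) = mat2 a b ?c ?d"
      using r(2) by (rule mat2_eq_transvections)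
    have "A = mat2 1 0 (- r) 1 **
      (mat2 1 ((a - 1) / ?c) 0 1 ** (mat2 1 0 ?c 1 ** mat2 1 ((?d - 1) / ?c) 0 1))"
      unfolding eq by (simp add: A(1) mat2_mult mat2_inject)
    with K show thesis by (rule transv)
  qed
  show thesis
  proof (cases "c = 0")
    case True
    with A(2) have "a \<noteq> 0" by auto
    then show thesis using *[of 1] True one_K by simp
  next
    case False
    then show thesis using *[of 0] zero_K by simp
  qed
qed

text \<open>Each of \<open>B\<close>, \<open>B'\<close> and \<open>E\<close> fills at least a
  fraction \<open>1 / (2 k)\<close> of its parameter range, and the condition on \<open>k\<close>
  makes this dense enough for \<open>diff_set_plus_dilate_eq\<close>.\<close>

lemma SL2_length_le:
  fixes l :: "'k ^ 2 ^ 2 \<Rightarrow> real"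
  assumes tri: "\<And>A C. A \<in> carrier (SL2 K) \<Longrightarrow> C \<in> carrier (SL2 K) \<Longrightarrow> l (A ** C) \<le> l A + l C"
    and B: "B \<subseteq> K" "\<And>b c. b \<in> B \<Longrightarrow> c \<in> B \<Longrightarrow> l (mat2 1 (b - c) 0 1) \<le> \<delta>"
    and B': "B' \<subseteq> K" "\<And>b c. b \<in> B' \<Longrightarrow> c \<in> B' \<Longrightarrow> l (mat2 1 0 (b - c) 1) \<le> \<delta>"
    and E: "E \<subseteq> K - {0}" "\<And>e f. e \<in> E \<Longrightarrow> f \<in> E \<Longrightarrow> l (mat2 (e / f) 0 0 (f / e)) \<le> \<delta>"
    and card: "card K \<le> 2 * k * card B" "card K \<le> 2 * k * card B'" "card K - 1 \<le> 2 * k * card E"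
    and k: "16 * k ^ 3 + 1 < card K"
    and A: "A \<in> carrier (SL2 K)"
  shows "l A \<le> 16 * \<delta>"
proof -
  have "card E \<noteq> 0" using card(3) k by (cases "card E = 0") auto
  then obtain f where f: "f \<in> E" and "finite E" by (auto simp: card_eq_0_iff)
  \<comment> \<open>Dividing by one fixed \<open>f\<close> preserves the cardinality of
    \<open>E\<close> and yields only ratios of two elements of \<open>E\<close>.\<close>
  let ?F = "(\<lambda>e. e / f) ` E"
  define S where "S = (\<lambda>x. x\<^sup>2) ` ?F"
  have FK: "?F \<subseteq> K" using E(1) f by (auto intro!: divide_K)
  then have SK: "S \<subseteq> K" by (auto simp: S_def power2_eq_square intro!: mult_K)
  have "f \<noteq> 0" using E(1) f by auto
  then have "card ?F = card E" by (intro card_image) (auto simp: inj_on_def)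
  then have S: "card E \<le> 2 * card S"
    using card_le_card_squares[of ?F] \<open>finite E\<close> by (simp add: S_def)
  \<comment> \<open>Here \<open>16 * k ^ 3 < card K - 1\<close>, which is at most
    \<open>2 * k * card E\<close> and so at most \<open>4 * k * card S\<close>. Hence
    \<open>4 * k\<^sup>2 < card S\<close>, which beats the square of the factor \<open>2 * k\<close>
    in the bound for \<open>C\<close>.\<close>
  have large: "(card K)\<^sup>2 < card S * (card C)\<^sup>2" if C: "card K \<le> 2 * k * card C" for C :: "'k set"
  proof -
    have "16 * k ^ 3 < 2 * k * card E" using card(3) k by linarith
    also have "\<dots> \<le> 2 * k * (2 * card S)" using S by (rule mult_le_mono2)
    finally have 1: "16 * k ^ 3 < 4 * k * card S" by simp
    then have "k > 0" by (cases k) auto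
    with 1 have "4 * k\<^sup>2 < card S" by (simp add: power3_eq_cube power2_eq_square)
    moreover have "card C > 0" using C k by (cases "card C = 0") auto
    ultimately have "(4 * k\<^sup>2) * (card C)\<^sup>2 < card S * (card C)\<^sup>2" by (intro mult_strict_right_mono) auto
    moreover have "(card K)\<^sup>2 \<le> (2 * k * card C)\<^sup>2" using C by (rule power_mono) simp
    ultimately show ?thesis by (auto simp: power_mult_distrib intro: le_less_trans)
  qed
  have diag: "mat2 e 0 0 (1 / e) \<in> carrier (SL2 K)" "mat2 (1 / e) 0 0 e \<in> carrier (SL2 K)"
    "l (mat2 e 0 0 (1 / e)) \<le> \<delta>" "l (mat2 (1 / e) 0 0 e) \<le> \<delta>" "e \<noteq> 0" "e \<in> K" if e: "e \<in> ?F" for e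
  proof -
    obtain c where c: "c \<in> E" "e = c / f" using e by auto
    with E(1) f show "e \<noteq> 0" "e \<in> K" by (auto intro: divide_K)
    then show "mat2 e 0 0 (1 / e) \<in> carrier (SL2 K)" "mat2 (1 / e) 0 0 e \<in> carrier (SL2 K)"
      using zero_K one_K by (auto simp: mat2_in_SL2_iff intro!: divide_K)
    show "l (mat2 e 0 0 (1 / e)) \<le> \<delta>" "l (mat2 (1 / e) 0 0 e) \<le> \<delta>"
      using E(2)[OF c(1) f] E(2)[OF f c(1)] by (simp_all add: c(2))
  qed
  interpret H: subgroup "carrier (SL2 K)" "SL2 (UNIV :: 'k set)" by (rule subgroup_SL2)
  \<comment> \<open>\<open>m\<close> stands for either unipotent family, \<open>D\<close> and
    \<open>D'\<close> for torus elements that dilate it by \<open>e\<^sup>2\<close>. These change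
    places between the upper and the lower family, on which the torus acts by inverse
    dilations.\<close>
  have dilate: "l (m t) \<le> 4 * \<delta>"
    if C: "C \<subseteq> K" "card K \<le> 2 * k * card C" "\<And>b c. b \<in> C \<Longrightarrow> c \<in> C \<Longrightarrow> l (m (b - c)) \<le> \<delta>"
      and m: "\<And>b. b \<in> K \<Longrightarrow> m b \<in> carrier (SL2 K)"
        "\<And>e b c. e \<noteq> 0 \<Longrightarrow> m (b + e\<^sup>2 * c) = m b ** (D e ** (m c ** D' e))"
      and D: "\<And>e. e \<in> ?F \<Longrightarrow> D e \<in> carrier (SL2 K) \<and> D' e \<in> carrier (SL2 K) \<and> l (D e) \<le> \<delta> \<and> l (D' e) \<le> \<delta>"
      and t: "t \<in> K" for C m D D' t
  proof -
    obtain e b1 b2 b3 b4 where e: "e \<in> ?F" and b: "b1 \<in> C" "b2 \<in> C" "b3 \<in> C" "b4 \<in> C"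
      and t': "t = (b1 - b2) + e\<^sup>2 * (b3 - b4)"
      using diff_set_plus_dilate_eq[OF C(1) SK large[OF C(2)]] t
      unfolding S_def image_iff bex_simps by blast
    let ?g = "m (b1 - b2)" and ?h = "m (b3 - b4)"
    have in_SL2: "?g \<in> carrier (SL2 K)" "?h \<in> carrier (SL2 K)"
      using b C(1) by (auto intro!: m(1) diff_K)
    have in_SL2': "?h ** D' e \<in> carrier (SL2 K)" "D e ** (?h ** D' e) \<in> carrier (SL2 K)"
      using in_SL2 D[OF e] H.m_closed by (auto simp: mult_SL2)
    have "l (m t) \<le> l ?g + (l (D e) + (l ?h + l (D' e)))"
      using tri[OF in_SL2(1) in_SL2'(2)] tri[OF _ in_SL2'(1), of "D e"] tri[OF in_SL2(2), of "D' e"] D[OF e]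
        m(2)[OF diag(5)[OF e], of "b1 - b2" "b3 - b4"] unfolding t' by auto
    then show ?thesis using D[OF e] C(3)[OF b(1,2)] C(3)[OF b(3,4)] by linarith
  qed
  have in_SL2: "mat2 1 x 0 1 \<in> carrier (SL2 K)" "mat2 1 0 x 1 \<in> carrier (SL2 K)" if "x \<in> K" for x
    using that zero_K one_K by (auto simp: mat2_in_SL2_iff)
  have upper: "l (mat2 1 t 0 1) \<le> 4 * \<delta>" if "t \<in> K" for t
    using B(1) card(1) B(2) in_SL2(1)
  proof (rule dilate)
    show "mat2 1 (b + e\<^sup>2 * c) 0 1 = mat2 1 b 0 1 ** (mat2 e 0 0 (1 / e) ** (mat2 1 c 0 1 ** mat2 (1 / e) 0 0 e))"
      if "e \<noteq> 0" for e b c :: 'k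
      using that by (simp add: mat2_mult mat2_inject power2_eq_square)
  qed (use diag that in auto)
  have lower: "l (mat2 1 0 t 1) \<le> 4 * \<delta>" if "t \<in> K" for t
    using B'(1) card(2) B'(2) in_SL2(2)
  proof (rule dilate)
    show "mat2 1 0 (b + e\<^sup>2 * c) 1 = mat2 1 0 b 1 ** (mat2 (1 / e) 0 0 e ** (mat2 1 0 c 1 ** mat2 e 0 0 (1 / e)))"
      if "e \<noteq> 0" for e b c :: 'k
      using that by (simp add: mat2_mult mat2_inject power2_eq_square)
  qed (use diag that in auto)
  obtain s t u v where K: "s \<in> K" "t \<in> K" "u \<in> K" "v \<in> K"
    and eq: "A = mat2 1 0 s 1 ** (mat2 1 t 0 1 ** (mat2 1 0 u 1 ** mat2 1 v 0 1))"
    using SL2_transvections[OF A] .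
  have in2: "mat2 1 0 u 1 ** mat2 1 v 0 1 \<in> carrier (SL2 K)"
    and in3: "mat2 1 t 0 1 ** (mat2 1 0 u 1 ** mat2 1 v 0 1) \<in> carrier (SL2 K)"
    using H.m_closed in_SL2 K by (auto simp: mult_SL2)
  have "l A \<le> l (mat2 1 0 s 1) + (l (mat2 1 t 0 1) + (l (mat2 1 0 u 1) + l (mat2 1 v 0 1)))"
    unfolding eq
    using tri[OF in_SL2(2)[OF K(1)] in3] tri[OF in_SL2(1)[OF K(2)] in2]
      tri[OF in_SL2(2)[OF K(3)] in_SL2(1)[OF K(4)]] by linarith
  with lower[OF K(1)] upper[OF K(2)] lower[OF K(3)] upper[OF K(4)] show ?thesis by linarith
qed

end


section \<open>Displacement and averaged semimetrics\<close>

text \<open>At least half of the indices avoid \<open>S 0\<close>, and the largest of the other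
  \<open>k\<close> classes has at least the average share of them.\<close>

lemma pigeonhole_half:
  assumes "finite I" and "k \<ge> 1" and cover: "\<And>i. i \<in> I \<Longrightarrow> \<exists>j\<le>k. c i \<in> S j"
    and half: "2 * card {i \<in> I. c i \<in> S 0} \<le> card I"
  shows "\<exists>j\<in>{1..k::nat}. card I \<le> 2 * k * card {i \<in> I. c i \<in> S j}"
proof (rule ccontr)
  assume "\<not> ?thesis"
  then have less: "2 * k * card {i \<in> I. c i \<in> S j} < card I" if "j \<in> {1..k}" for j using that by force
  have "I = (\<Union>j\<le>k. {i \<in> I. c i \<in> S j})" using cover by auto
  then have "card I \<le> (\<Sum>j\<le>k. card {i \<in> I. c i \<in> S j})" by (metis card_UN_le finite_atMost)
  also have "\<dots> = card {i \<in> I. c i \<in> S 0} + (\<Sum>j=1..k. card {i \<in> I. c i \<in> S j})"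
    by (simp add: sum.atMost_shift atMost_atLeast0 sum.atLeast_Suc_atMost)
  finally have "card I \<le> 2 * (\<Sum>j=1..k. card {i \<in> I. c i \<in> S j})" using half by simp
  then have "k * card I \<le> k * (2 * (\<Sum>j=1..k. card {i \<in> I. c i \<in> S j}))" by (rule mult_le_mono2)
  also have "\<dots> = (\<Sum>j=1..k. 2 * k * card {i \<in> I. c i \<in> S j})" by (simp add: sum_distrib_left mult_ac)
  also have "\<dots> < (\<Sum>j=1..k. card I)"
    using assms(2) by (intro sum_strict_mono less) auto
  finally show False by simp
qed

lemma semimetric_diam_lessD:
  assumes "semimetric_diam \<rho> A < ereal \<delta>" and "x \<in> A" and "y \<in> A"
  shows "\<rho> x y < \<delta>"
proof -
  have "ereal (\<rho> x y) \<le> semimetric_diam \<rho> A"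
    unfolding semimetric_diam_def using assms(2,3) by (intro SUP_upper2[of "(x, y)"]) auto
  with assms(1) show ?thesis using ereal_less_eq(3) by (metis less_ereal.simps(1) order_le_less_trans)
qed

text \<open>The same cells serve the smaller function; this passes from a semimetric to its
  truncation at 1.\<close>

lemma entropy_partition_mono:
  assumes "entropy_partition M \<rho> \<epsilon> k"
    and "\<And>x y. x \<in> space M \<Longrightarrow> y \<in> space M \<Longrightarrow> \<sigma> x y \<le> \<rho> x y"
  shows "entropy_partition M \<sigma> \<epsilon> k"
proof -
  obtain S where S: "\<forall>i\<le>k. S i \<in> sets M" "space M = (\<Union>i\<le>k. S i)" "measure M (S 0) < \<epsilon>"
    "\<forall>i\<in>{1..k}. semimetric_diam \<rho> (S i) < ereal \<epsilon>"
    using assms(1) unfolding entropy_partition_def by blast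
  have "semimetric_diam \<sigma> (S i) < ereal \<epsilon>" if i: "i \<in> {1..k}" for i
  proof -
    have "semimetric_diam \<sigma> (S i) \<le> semimetric_diam \<rho> (S i)"
      unfolding semimetric_diam_def
    proof (rule SUP_mono)
      fix z assume "z \<in> S i \<times> S i"
      moreover have "S i \<subseteq> space M" using S(2) i by auto
      ultimately show "\<exists>w\<in>S i \<times> S i. (case z of (x, y) \<Rightarrow> ereal (\<sigma> x y)) \<le> (case w of (x, y) \<Rightarrow> ereal (\<rho> x y))"
        using assms(2) by (intro bexI[of _ z]) (auto simp: subset_iff)
    qed
    with S(4) i show ?thesis using le_less_trans by blast
  qed
  with S(1-3) show ?thesis unfolding entropy_partition_def by blast
qed

context group_action
begin

lemma act_closed: "g \<in> carrier G \<Longrightarrow> x \<in> E \<Longrightarrow> \<phi> g x \<in> E"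
  using element_image by blast

text \<open>Right multiplication by \<open>g\<close> permutes \<open>H\<close>, so the sum is only
  reindexed.\<close>

lemma averaged_semimetric_invariant:
  assumes H: "subgroup H G" and g: "g \<in> H" and "x \<in> E" and "y \<in> E"
  shows "averaged_semimetric \<phi> H \<rho> (\<phi> g x) (\<phi> g y) = averaged_semimetric \<phi> H \<rho> x y"
proof -
  interpret group G using group_hom by (rule group_hom.axioms(1))
  interpret H: subgroup H G by (rule H)
  have "(\<Sum>h\<in>H. \<rho> (\<phi> h (\<phi> g x)) (\<phi> h (\<phi> g y))) = (\<Sum>h\<in>H. \<rho> (\<phi> (h \<otimes> g) x) (\<phi> (h \<otimes> g) y))"
    using assms H.subset by (intro sum.cong refl) (auto simp: composition_rule subset_iff)
  also have "\<dots> = (\<Sum>h\<in>H. \<rho> (\<phi> h x) (\<phi> h y))"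
    using g H.subset
    by (intro sum.reindex_bij_witness[of _ "\<lambda>h. h \<otimes> inv g" "\<lambda>h. h \<otimes> g"])
       (auto simp: m_assoc subset_iff)
  finally show ?thesis by (simp add: averaged_semimetric_def)
qed

end

text \<open>Measurability is imposed along the graph of each group element, where the displacement
  integrals are taken.\<close>

locale pmp_semimetric = prob_space M + group_action G "space M" \<alpha>
  for M :: "'x measure" and G :: "('g, 'b) monoid_scheme" and \<alpha> +
  fixes r :: "'x \<Rightarrow> 'x \<Rightarrow> real"
  assumes act_measurable: "\<And>g. g \<in> carrier G \<Longrightarrow> \<alpha> g \<in> measurable M M"
    and act_distr: "\<And>g. g \<in> carrier G \<Longrightarrow> distr M M (\<alpha> g) = M"
    and r_nonneg: "\<And>x y. x \<in> space M \<Longrightarrow> y \<in> space M \<Longrightarrow> 0 \<le> r x y"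
    and r_le_1: "\<And>x y. x \<in> space M \<Longrightarrow> y \<in> space M \<Longrightarrow> r x y \<le> 1"
    and r_triangle: "\<And>x y z. x \<in> space M \<Longrightarrow> y \<in> space M \<Longrightarrow> z \<in> space M \<Longrightarrow> r x z \<le> r x y + r y z"
    and r_measurable: "\<And>g. g \<in> carrier G \<Longrightarrow> (\<lambda>x. r x (\<alpha> g x)) \<in> borel_measurable M"
begin

definition displacement :: "'g \<Rightarrow> real" where
  "displacement g = (\<integral>x. r x (\<alpha> g x) \<partial>M)"

sublocale group G
  using group_hom by (rule group_hom.axioms(1))

lemma integral_act:
  fixes f :: "'x \<Rightarrow> real"
  assumes "g \<in> carrier G" and "f \<in> borel_measurable M"
  shows "(\<integral>x. f (\<alpha> g x) \<partial>M) = (\<integral>x. f x \<partial>M)"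
  using integral_distr[OF act_measurable[OF assms(1)] assms(2)] act_distr[OF assms(1)] by simp

lemma integrable_displacement:
  assumes "g \<in> carrier G"
  shows "integrable M (\<lambda>x. r x (\<alpha> g x))"
  using assms act_closed r_nonneg r_le_1
  by (intro integrable_const_bound[where B = 1] r_measurable AE_I2) auto

lemma integrable_displacement_act:
  assumes "g \<in> carrier G" and "h \<in> carrier G"
  shows "integrable M (\<lambda>x. r (\<alpha> h x) (\<alpha> g (\<alpha> h x)))"
  using integrable_distr[OF act_measurable[OF assms(2)], of "\<lambda>x. r x (\<alpha> g x)"]
    integrable_displacement[OF assms(1)] act_distr[OF assms(2)] by simp

lemma displacement_nonneg: "g \<in> carrier G \<Longrightarrow> 0 \<le> displacement g"
  unfolding displacement_def using act_closed r_nonneg by (intro Bochner_Integration.integral_nonneg) auto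

text \<open>The triangle inequality through \<open>\<alpha> h x\<close> leaves the integrand of
  \<open>displacement g\<close> evaluated at \<open>\<alpha> h x\<close>, and \<open>h\<close>
  preserves the measure.\<close>

lemma displacement_mult:
  assumes g: "g \<in> carrier G" and h: "h \<in> carrier G"
  shows "displacement (g \<otimes>\<^bsub>G\<^esub> h) \<le> displacement g + displacement h"
proof -
  have "displacement (g \<otimes>\<^bsub>G\<^esub> h) \<le> (\<integral>x. r x (\<alpha> h x) + r (\<alpha> h x) (\<alpha> g (\<alpha> h x)) \<partial>M)"
    unfolding displacement_def
  proof (rule integral_mono)
    show "integrable M (\<lambda>x. r x (\<alpha> (g \<otimes>\<^bsub>G\<^esub> h) x))" using g h by (intro integrable_displacement) simp
    show "integrable M (\<lambda>x. r x (\<alpha> h x) + r (\<alpha> h x) (\<alpha> g (\<alpha> h x)))"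
      using g h by (intro Bochner_Integration.integrable_add integrable_displacement integrable_displacement_act)
    show "r x (\<alpha> (g \<otimes>\<^bsub>G\<^esub> h) x) \<le> r x (\<alpha> h x) + r (\<alpha> h x) (\<alpha> g (\<alpha> h x))" if "x \<in> space M" for x
      using that g h r_triangle[of x "\<alpha> h x" "\<alpha> g (\<alpha> h x)"] act_closed composition_rule by simp
  qed
  also have "\<dots> = displacement h + (\<integral>x. r (\<alpha> h x) (\<alpha> g (\<alpha> h x)) \<partial>M)"
    unfolding displacement_def using g h
    by (intro Bochner_Integration.integral_add integrable_displacement integrable_displacement_act)
  also have "(\<integral>x. r (\<alpha> h x) (\<alpha> g (\<alpha> h x)) \<partial>M) = displacement g"
    unfolding displacement_def using integral_act[OF h r_measurable[OF g]] .
  finally show ?thesis by simp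
qed

text \<open>With \<open>y = \<alpha> h x\<close>, the point \<open>\<alpha> h (\<alpha> g x)\<close>
  is the image of \<open>y\<close> under the conjugate of \<open>g\<close> by \<open>h\<close>.
  Invariance of the measure lets \<open>y\<close> take the place of \<open>x\<close> in the
  integral.\<close>

lemma averaged_displacement:
  assumes H: "subgroup H G" and g: "g \<in> H"
  shows "integrable M (\<lambda>x. averaged_semimetric \<alpha> H r x (\<alpha> g x))"
    and "(\<integral>x. averaged_semimetric \<alpha> H r x (\<alpha> g x) \<partial>M)
      = (\<Sum>h\<in>H. displacement (h \<otimes>\<^bsub>G\<^esub> g \<otimes>\<^bsub>G\<^esub> inv\<^bsub>G\<^esub> h)) / real (card H)"
proof -
  interpret H: subgroup H G by (rule H)
  have gh: "h \<otimes>\<^bsub>G\<^esub> g \<otimes>\<^bsub>G\<^esub> inv\<^bsub>G\<^esub> h \<in> carrier G" "h \<in> carrier G" "g \<in> carrier G" if "h \<in> H" for h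
    using that g H.mem_carrier by auto
  have eq: "r (\<alpha> h x) (\<alpha> h (\<alpha> g x)) = r (\<alpha> h x) (\<alpha> (h \<otimes>\<^bsub>G\<^esub> g \<otimes>\<^bsub>G\<^esub> inv\<^bsub>G\<^esub> h) (\<alpha> h x))"
    if h: "h \<in> H" and x: "x \<in> space M" for h x
  proof -
    have "\<alpha> (h \<otimes>\<^bsub>G\<^esub> g \<otimes>\<^bsub>G\<^esub> inv\<^bsub>G\<^esub> h) (\<alpha> h x) = \<alpha> (h \<otimes>\<^bsub>G\<^esub> g \<otimes>\<^bsub>G\<^esub> inv\<^bsub>G\<^esub> h \<otimes>\<^bsub>G\<^esub> h) x"
      using gh[OF h] x composition_rule by simp
    also have "h \<otimes>\<^bsub>G\<^esub> g \<otimes>\<^bsub>G\<^esub> inv\<^bsub>G\<^esub> h \<otimes>\<^bsub>G\<^esub> h = h \<otimes>\<^bsub>G\<^esub> g"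
      using gh[OF h] by (simp add: m_assoc)
    also have "\<alpha> (h \<otimes>\<^bsub>G\<^esub> g) x = \<alpha> h (\<alpha> g x)"
      using gh[OF h] x composition_rule by simp
    finally show ?thesis by simp
  qed
  have int: "integrable M (\<lambda>x. r (\<alpha> h x) (\<alpha> h (\<alpha> g x)))" if "h \<in> H" for h
    using integrable_displacement_act[OF gh(1,2)[OF that]] eq[OF that]
    by (subst Bochner_Integration.integrable_cong[OF refl]) auto
  then show "integrable M (\<lambda>x. averaged_semimetric \<alpha> H r x (\<alpha> g x))"
    unfolding averaged_semimetric_def by auto
  have "(\<integral>x. r (\<alpha> h x) (\<alpha> h (\<alpha> g x)) \<partial>M) = displacement (h \<otimes>\<^bsub>G\<^esub> g \<otimes>\<^bsub>G\<^esub> inv\<^bsub>G\<^esub> h)"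
    if h: "h \<in> H" for h
  proof -
    have "(\<integral>x. r (\<alpha> h x) (\<alpha> h (\<alpha> g x)) \<partial>M)
      = (\<integral>x. r (\<alpha> h x) (\<alpha> (h \<otimes>\<^bsub>G\<^esub> g \<otimes>\<^bsub>G\<^esub> inv\<^bsub>G\<^esub> h) (\<alpha> h x)) \<partial>M)"
      using eq[OF h] by (intro Bochner_Integration.integral_cong) auto
    also have "\<dots> = displacement (h \<otimes>\<^bsub>G\<^esub> g \<otimes>\<^bsub>G\<^esub> inv\<^bsub>G\<^esub> h)"
      unfolding displacement_def using integral_act[OF gh(2)[OF h] r_measurable[OF gh(1)[OF h]]] .
    finally show ?thesis .
  qed
  with int show "(\<integral>x. averaged_semimetric \<alpha> H r x (\<alpha> g x) \<partial>M)
      = (\<Sum>h\<in>H. displacement (h \<otimes>\<^bsub>G\<^esub> g \<otimes>\<^bsub>G\<^esub> inv\<^bsub>G\<^esub> h)) / real (card H)"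
    unfolding averaged_semimetric_def by (simp add: Bochner_Integration.integral_sum)
qed

text \<open>
  Averaging over conjugates makes the bound on the averaged semimetric one for the mean of the
  displacement, and \<open>g = (g h) h\<^sup>-\<^sup>1\<close> turns the mean into a uniform bound.
\<close>

lemma displacement_le_of_averaged:
  assumes H: "subgroup H G" "finite H" and g: "g \<in> H"
    and le: "\<And>h. h \<in> H \<Longrightarrow> (\<integral>x. averaged_semimetric \<alpha> H r x (\<alpha> h x) \<partial>M) \<le> c"
  shows "displacement g \<le> 2 * c"
proof -
  interpret H: subgroup H G by (rule H(1))
  have card: "card H > 0" using H(2) g by (auto simp: card_gt_0_iff)
  have "(\<Sum>k\<in>H. displacement (h \<otimes>\<^bsub>G\<^esub> k \<otimes>\<^bsub>G\<^esub> inv\<^bsub>G\<^esub> h)) = (\<Sum>k\<in>H. displacement k)" if h: "h \<in> H" for h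
    using h H.mem_carrier
    by (intro sum.reindex_bij_witness[of _ "\<lambda>k. inv\<^bsub>G\<^esub> h \<otimes>\<^bsub>G\<^esub> k \<otimes>\<^bsub>G\<^esub> h" "\<lambda>k. h \<otimes>\<^bsub>G\<^esub> k \<otimes>\<^bsub>G\<^esub> inv\<^bsub>G\<^esub> h"])
       (simp_all add: m_assoc, simp_all add: m_assoc[symmetric])
  then have "card H * (\<Sum>k\<in>H. displacement k)
      = (\<Sum>h\<in>H. \<Sum>k\<in>H. displacement (h \<otimes>\<^bsub>G\<^esub> k \<otimes>\<^bsub>G\<^esub> inv\<^bsub>G\<^esub> h))" by simp
  also have "\<dots> = (\<Sum>k\<in>H. \<Sum>h\<in>H. displacement (h \<otimes>\<^bsub>G\<^esub> k \<otimes>\<^bsub>G\<^esub> inv\<^bsub>G\<^esub> h))" by (rule sum.swap)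
  also have "\<dots> \<le> (\<Sum>k\<in>H. card H * c)"
    using le card by (intro sum_mono) (simp add: averaged_displacement(2)[OF H(1)] field_simps)
  finally have sum: "(\<Sum>k\<in>H. displacement k) \<le> card H * c" using card by (simp add: mult_le_cancel_left)
  have "card H * displacement g = (\<Sum>h\<in>H. displacement g)" by simp
  also have "\<dots> \<le> (\<Sum>h\<in>H. displacement (g \<otimes>\<^bsub>G\<^esub> h) + displacement (inv\<^bsub>G\<^esub> h))"
  proof (rule sum_mono)
    fix h assume h: "h \<in> H"
    then have "g = (g \<otimes>\<^bsub>G\<^esub> h) \<otimes>\<^bsub>G\<^esub> inv\<^bsub>G\<^esub> h" using g H.mem_carrier by (simp add: m_assoc)
    then show "displacement g \<le> displacement (g \<otimes>\<^bsub>G\<^esub> h) + displacement (inv\<^bsub>G\<^esub> h)"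
      using displacement_mult[of "g \<otimes>\<^bsub>G\<^esub> h" "inv\<^bsub>G\<^esub> h"] g h H.mem_carrier by simp
  qed
  also have "\<dots> = (\<Sum>h\<in>H. displacement (g \<otimes>\<^bsub>G\<^esub> h)) + (\<Sum>h\<in>H. displacement (inv\<^bsub>G\<^esub> h))"
    by (rule sum.distrib)
  also have "(\<Sum>h\<in>H. displacement (g \<otimes>\<^bsub>G\<^esub> h)) = (\<Sum>h\<in>H. displacement h)"
    using g H.mem_carrier
    by (intro sum.reindex_bij_witness[of _ "\<lambda>h. inv\<^bsub>G\<^esub> g \<otimes>\<^bsub>G\<^esub> h" "\<lambda>h. g \<otimes>\<^bsub>G\<^esub> h"])
       (simp_all add: m_assoc[symmetric])
  also have "(\<Sum>h\<in>H. displacement (inv\<^bsub>G\<^esub> h)) = (\<Sum>h\<in>H. displacement h)"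
    using H.mem_carrier by (intro sum.reindex_bij_witness[of _ "\<lambda>h. inv\<^bsub>G\<^esub> h" "\<lambda>h. inv\<^bsub>G\<^esub> h"]) simp_all
  finally have "card H * displacement g \<le> card H * (2 * c)" using sum by simp
  then show ?thesis using card by simp
qed

lemma averaged_semimetric_le_1:
  assumes H: "subgroup H G" and x: "x \<in> space M" and y: "y \<in> space M"
  shows "averaged_semimetric \<alpha> H r x y \<le> 1"
proof -
  interpret H: subgroup H G by (rule H(1))
  have act: "\<alpha> h x \<in> space M" "\<alpha> h y \<in> space M" if "h \<in> H" for h
    using that x y act_closed H.mem_carrier by auto
  have "(\<Sum>h\<in>H. r (\<alpha> h x) (\<alpha> h y)) \<le> (\<Sum>h\<in>H. 1)" using act r_le_1 by (intro sum_mono) auto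
  then show "averaged_semimetric \<alpha> H r x y \<le> 1"
    unfolding averaged_semimetric_def by (auto simp: divide_le_eq_1)
qed

lemma averaged_semimetric_triangle:
  assumes H: "subgroup H G" and "x \<in> space M" and "y \<in> space M" and "z \<in> space M"
  shows "averaged_semimetric \<alpha> H r x z \<le> averaged_semimetric \<alpha> H r x y + averaged_semimetric \<alpha> H r y z"
proof -
  interpret H: subgroup H G by (rule H(1))
  have "(\<Sum>h\<in>H. r (\<alpha> h x) (\<alpha> h z)) \<le> (\<Sum>h\<in>H. r (\<alpha> h x) (\<alpha> h y) + r (\<alpha> h y) (\<alpha> h z))"
    using assms act_closed H.mem_carrier by (intro sum_mono r_triangle) auto
  then show ?thesis
    unfolding averaged_semimetric_def
    by (simp add: sum.distrib add_divide_distrib[symmetric] divide_right_mono)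
qed

text \<open>Invariance under \<open>h\<close>, in the form that gives both the subadditivity of the
  length function and the comparison of two orbit points in one cell.\<close>

lemma averaged_semimetric_act_mult:
  assumes H: "subgroup H G" and "g \<in> H" and "h \<in> H" and x: "x \<in> space M"
  shows "averaged_semimetric \<alpha> H r (\<alpha> h x) (\<alpha> (h \<otimes>\<^bsub>G\<^esub> g) x) = averaged_semimetric \<alpha> H r x (\<alpha> g x)"
proof -
  interpret H: subgroup H G by (rule H(1))
  show ?thesis
    using averaged_semimetric_invariant[OF H \<open>h \<in> H\<close> x, of "\<alpha> g x"] assms composition_rule[OF x]
      act_closed H.mem_carrier by simp
qed

end

text \<open>Linearity of the integral and invariance of the measure. Taken for the exceptional cell
  \<open>S 0\<close>, it bounds how often orbits meet that cell on average.\<close>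

lemma (in pmp_semimetric) mean_number_of_visits:
  assumes I: "finite I" "\<And>i. i \<in> I \<Longrightarrow> c i \<in> carrier G" and A: "A \<in> sets M"
  shows "integrable M (\<lambda>x. real (card {i \<in> I. \<alpha> (c i) x \<in> A}))"
    and "(\<integral>x. real (card {i \<in> I. \<alpha> (c i) x \<in> A}) \<partial>M) = card I * measure M A"
proof -
  have eq: "real (card {i \<in> I. \<alpha> (c i) x \<in> A}) = (\<Sum>i\<in>I. indicat_real A (\<alpha> (c i) x))" for x
    using I(1) by (simp add: indicator_def sum.If_cases Int_def)
  have int: "integrable M (\<lambda>x. indicat_real A (\<alpha> (c i) x))" if "i \<in> I" for i
    using act_measurable[OF I(2)[OF that]] A
    by (intro integrable_const_bound[where B = 1]) (auto simp: indicator_def)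
  then show "integrable M (\<lambda>x. real (card {i \<in> I. \<alpha> (c i) x \<in> A}))"
    unfolding eq by (intro Bochner_Integration.integrable_sum)
  have "(\<integral>x. indicat_real A (\<alpha> (c i) x) \<partial>M) = measure M A" if "i \<in> I" for i
    using integral_act[OF I(2)[OF that], of "indicat_real A"] A
    by (simp add: sets.sets_into_space Int_absorb2)
  with int show "(\<integral>x. real (card {i \<in> I. \<alpha> (c i) x \<in> A}) \<partial>M) = card I * measure M A"
    unfolding eq by (simp add: Bochner_Integration.integral_sum)
qed

section \<open>Small displacement for SL(2) from coverings by sets of small diameter\<close>

locale SL2_semimetric =
  pmp_semimetric M "SL2 (UNIV :: 'k set)" \<alpha> r + finite_subfield K
  for M :: "'x measure" and \<alpha> and r and K :: "'k::field set"
begin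

abbreviation "r_av \<equiv> averaged_semimetric \<alpha> (carrier (SL2 K)) r"

lemma one_parameter_in_SL2:
  "b \<in> K \<Longrightarrow> mat2 1 b 0 1 \<in> carrier (SL2 K)"
  "b \<in> K \<Longrightarrow> mat2 1 0 b 1 \<in> carrier (SL2 K)"
  "e \<in> K - {0} \<Longrightarrow> mat2 e 0 0 (1 / e) \<in> carrier (SL2 K)"
  using zero_K one_K by (auto simp: mat2_in_SL2_iff intro!: divide_K)

text \<open>The three hypotheses on \<open>S 0\<close> let the pigeonhole principle act on the
  orbits of \<open>x\<close> under the unipotents and the torus; the parameters that land in one
  common cell are the sets required by \<open>SL2_length_le\<close>.\<close>

lemma averaged_displacement_pointwise:
  assumes k: "k \<ge> 1" "16 * k ^ 3 + 1 < card K"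
    and cover: "space M = (\<Union>j\<le>k. S j)"
    and diam: "\<And>j y z. j \<in> {1..k} \<Longrightarrow> y \<in> S j \<Longrightarrow> z \<in> S j \<Longrightarrow> r_av y z \<le> \<delta>"
    and x: "x \<in> space M"
    and upper: "2 * card {b \<in> K. \<alpha> (mat2 1 b 0 1) x \<in> S 0} \<le> card K"
    and lower: "2 * card {b \<in> K. \<alpha> (mat2 1 0 b 1) x \<in> S 0} \<le> card K"
    and diag: "2 * card {e \<in> K - {0}. \<alpha> (mat2 e 0 0 (1 / e)) x \<in> S 0} \<le> card (K - {0})"
    and A: "A \<in> carrier (SL2 K)"
  shows "r_av x (\<alpha> A x) \<le> 16 * \<delta>"
proof -
  interpret H: subgroup "carrier (SL2 K)" "SL2 (UNIV :: 'k set)" by (rule subgroup_SL2)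
  have act: "\<alpha> C y \<in> space M" if "C \<in> carrier (SL2 K)" "y \<in> space M" for C y
    using that act_closed H.mem_carrier by blast
  have orbit: "\<exists>j\<in>{1..k}. card I \<le> 2 * k * card {i \<in> I. \<alpha> (c i) x \<in> S j}"
    if "I \<subseteq> K" "\<And>i. i \<in> I \<Longrightarrow> c i \<in> carrier (SL2 K)" "2 * card {i \<in> I. \<alpha> (c i) x \<in> S 0} \<le> card I" for I c
  proof (rule pigeonhole_half)
    show "finite I" using that(1) finite_K finite_subset by blast
    show "\<exists>j\<le>k. \<alpha> (c i) x \<in> S j" if "i \<in> I" for i
      using act[OF \<open>i \<in> I \<Longrightarrow> c i \<in> _\<close> x] that cover by auto
  qed (use that k in auto)
  obtain ju where ju: "ju \<in> {1..k}" "card K \<le> 2 * k * card {b \<in> K. \<alpha> (mat2 1 b 0 1) x \<in> S ju}"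
    using orbit[of K "\<lambda>b. mat2 1 b 0 1"] one_parameter_in_SL2 upper by auto
  obtain jl where jl: "jl \<in> {1..k}" "card K \<le> 2 * k * card {b \<in> K. \<alpha> (mat2 1 0 b 1) x \<in> S jl}"
    using orbit[of K "\<lambda>b. mat2 1 0 b 1"] one_parameter_in_SL2 lower by auto
  obtain jd where jd: "jd \<in> {1..k}"
    "card (K - {0}) \<le> 2 * k * card {e \<in> K - {0}. \<alpha> (mat2 e 0 0 (1 / e)) x \<in> S jd}"
    using orbit[of "K - {0}" "\<lambda>e. mat2 e 0 0 (1 / e)"] one_parameter_in_SL2(3) diag by auto
  \<comment> \<open>The inverse of \<open>P\<close> moves two orbit points of one cell to
    \<open>x\<close> and \<open>\<alpha> C x\<close> without changing \<open>r_av\<close>. For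
    unipotents \<open>C\<close> carries a difference of parameters, for the torus a ratio.\<close>
  have ratio: "r_av x (\<alpha> C x) \<le> \<delta>"
    if "C \<in> carrier (SL2 K)" "P \<in> carrier (SL2 K)" "\<alpha> P x \<in> S i" "\<alpha> (P ** C) x \<in> S i" "i \<in> {1..k}" for P C i
    using diam[OF that(5,3,4)] averaged_semimetric_act_mult[OF subgroup_SL2 that(1,2) x] by (simp add: mult_SL2)
  show ?thesis
  proof (rule SL2_length_le[where l = "\<lambda>C. r_av x (\<alpha> C x)"])
    fix B C assume BC: "B \<in> carrier (SL2 K)" "C \<in> carrier (SL2 K)"
    have "r_av x (\<alpha> (B ** C) x) \<le> r_av x (\<alpha> B x) + r_av (\<alpha> B x) (\<alpha> (B ** C) x)"
      using BC x act H.m_closed[OF BC]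
      by (intro averaged_semimetric_triangle subgroup_SL2) (auto simp: mult_SL2)
    also have "r_av (\<alpha> B x) (\<alpha> (B ** C) x) = r_av x (\<alpha> C x)"
      using averaged_semimetric_act_mult[OF subgroup_SL2 BC(2,1) x] by (simp add: mult_SL2)
    finally show "r_av x (\<alpha> (B ** C) x) \<le> r_av x (\<alpha> B x) + r_av x (\<alpha> C x)" .
  next
    fix b c assume "b \<in> {b \<in> K. \<alpha> (mat2 1 b 0 1) x \<in> S ju}" "c \<in> {b \<in> K. \<alpha> (mat2 1 b 0 1) x \<in> S ju}"
    then show "r_av x (\<alpha> (mat2 1 (b - c) 0 1) x) \<le> \<delta>"
      using ju(1) by (intro ratio[of _ "mat2 1 c 0 1" ju])
        (auto simp: mat2_mult intro!: one_parameter_in_SL2 diff_K)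
  next
    fix b c assume "b \<in> {b \<in> K. \<alpha> (mat2 1 0 b 1) x \<in> S jl}" "c \<in> {b \<in> K. \<alpha> (mat2 1 0 b 1) x \<in> S jl}"
    then show "r_av x (\<alpha> (mat2 1 0 (b - c) 1) x) \<le> \<delta>"
      using jl(1) by (intro ratio[of _ "mat2 1 0 c 1" jl])
        (auto simp: mat2_mult intro!: one_parameter_in_SL2 diff_K)
  next
    fix e f assume "e \<in> {e \<in> K - {0}. \<alpha> (mat2 e 0 0 (1 / e)) x \<in> S jd}"
      "f \<in> {e \<in> K - {0}. \<alpha> (mat2 e 0 0 (1 / e)) x \<in> S jd}"
    then show "r_av x (\<alpha> (mat2 (e / f) 0 0 (f / e)) x) \<le> \<delta>"
      using jd(1) one_parameter_in_SL2(3)[of "e / f"]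
      by (intro ratio[of _ "mat2 f 0 0 (1 / f)" jd])
        (auto simp: mat2_mult intro!: one_parameter_in_SL2 divide_K)
  next
    show "card K - 1 \<le> 2 * k * card {e \<in> K - {0}. \<alpha> (mat2 e 0 0 (1 / e)) x \<in> S jd}"
      using jd(2) zero_K finite_K by (simp add: card_Diff_singleton)
  qed (use ju(2) jl(2) k A in auto)
qed

lemma displacement_le_of_entropy_partition:
  assumes k: "k \<ge> 1" "16 * k ^ 3 + 1 < card K"
    and part: "entropy_partition M r_av \<delta> k"
    and A: "A \<in> carrier (SL2 K)"
  shows "displacement A \<le> 44 * \<delta>"
proof -
  interpret H: subgroup "carrier (SL2 K)" "SL2 (UNIV :: 'k set)" by (rule subgroup_SL2)
  obtain S where S: "\<forall>i\<le>k. S i \<in> sets M" "space M = (\<Union>i\<le>k. S i)" "measure M (S 0) < \<delta>"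
    "\<forall>i\<in>{1..k}. semimetric_diam r_av (S i) < ereal \<delta>"
    using part unfolding entropy_partition_def by blast
  have \<delta>: "\<delta> > 0" using S(3) measure_nonneg[of M "S 0"] by linarith
  have S0: "S 0 \<in> sets M" using S(1) by simp
  have diam: "r_av y z \<le> \<delta>" if "j \<in> {1..k}" "y \<in> S j" "z \<in> S j" for j y z
    using semimetric_diam_lessD[OF bspec[OF S(4) that(1)] that(2,3)] by simp
  define v where "v I c x = real (card {i \<in> I. \<alpha> (c i) x \<in> S 0}) / card I" for I and c :: "'k \<Rightarrow> 'k ^ 2 ^ 2" and x
  have v: "integrable M (v I c) \<and> (\<integral>x. v I c x \<partial>M) \<le> \<delta>"
    if "I \<subseteq> K" "\<And>i. i \<in> I \<Longrightarrow> c i \<in> carrier (SL2 K)" for I c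
  proof -
    have "finite I" "\<And>i. i \<in> I \<Longrightarrow> c i \<in> carrier (SL2 UNIV)"
      using that finite_K finite_subset H.mem_carrier by blast+
    from mean_number_of_visits[OF this S0] S(3) \<delta> show ?thesis by (simp add: v_def[abs_def])
  qed
  have v_nonneg: "0 \<le> v I c x" for I c x by (simp add: v_def)
  have v_le: "2 * card {i \<in> I. \<alpha> (c i) x \<in> S 0} \<le> card I" if "v I c x \<le> 1 / 2" "finite I" for I c x
    using that by (cases "card I = 0") (auto simp: v_def field_simps)
  define u l d where "u = v K (\<lambda>b. mat2 1 b 0 1)" and "l = v K (\<lambda>b. mat2 1 0 b 1)"
    and "d = v (K - {0}) (\<lambda>e. mat2 e 0 0 (1 / e))"
  have u_int: "integrable M u \<and> (\<integral>x. u x \<partial>M) \<le> \<delta>" and l_int: "integrable M l \<and> (\<integral>x. l x \<partial>M) \<le> \<delta>"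
    and d_int: "integrable M d \<and> (\<integral>x. d x \<partial>M) \<le> \<delta>"
    unfolding u_def l_def d_def by (rule v; use one_parameter_in_SL2 in auto)+
  have finite: "finite (carrier (SL2 K))" using finite_K by (rule finite_carrier_SL2)
  \<comment> \<open>The constant is 16 from the pointwise bound plus 2 for each of the three visit
    frequencies, whose means are at most \<open>\<delta>\<close>;
    \<open>displacement_le_of_averaged\<close> doubles it to 44.\<close>
  have "(\<integral>x. r_av x (\<alpha> C x) \<partial>M) \<le> 22 * \<delta>" if C: "C \<in> carrier (SL2 K)" for C
  proof -
    have "r_av x (\<alpha> C x) \<le> 16 * \<delta> + (2 * u x + 2 * l x + 2 * d x)" if x: "x \<in> space M" for x
    proof -
      have nonneg: "0 \<le> u x" "0 \<le> l x" "0 \<le> d x" by (simp_all add: u_def l_def d_def v_nonneg)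
      show ?thesis
      proof (cases "u x \<le> 1 / 2 \<and> l x \<le> 1 / 2 \<and> d x \<le> 1 / 2")
        case True
        have "r_av x (\<alpha> C x) \<le> 16 * \<delta>"
          using True C finite_K
          by (intro averaged_displacement_pointwise[OF k S(2) diam x] v_le) (auto simp: u_def l_def d_def)
        with nonneg show ?thesis by linarith
      next
        \<comment> \<open>Some frequency exceeds one half, so its double exceeds the trivial bound
          1.\<close>
        case False
        moreover have "r_av x (\<alpha> C x) \<le> 1"
          using x C act_closed H.mem_carrier by (intro averaged_semimetric_le_1 subgroup_SL2) auto
        ultimately show ?thesis
          using \<delta> nonneg by linarith
      qed
    qed
    then have "(\<integral>x. r_av x (\<alpha> C x) \<partial>M) \<le> (\<integral>x. 16 * \<delta> + (2 * u x + 2 * l x + 2 * d x) \<partial>M)"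
      using u_int l_int d_int averaged_displacement(1)[OF subgroup_SL2 C] by (intro integral_mono) auto
    also have "\<dots> = 16 * \<delta> + (2 * (\<integral>x. u x \<partial>M) + 2 * (\<integral>x. l x \<partial>M) + 2 * (\<integral>x. d x \<partial>M))"
      using u_int l_int d_int by (simp add: prob_space)
    finally show ?thesis using u_int l_int d_int by linarith
  qed
  from displacement_le_of_averaged[OF subgroup_SL2 finite A this] show ?thesis by simp
qed

end


section \<open>Measurability on graphs\<close>

lemma (in complete_measure) borel_measurable_AE_eq:
  fixes f g :: "'a \<Rightarrow> real"
  assumes f: "f \<in> borel_measurable M" and eq: "AE x in M. f x = g x"
  shows "g \<in> borel_measurable M"
proof (rule borel_measurableI)
  fix S :: "real set" assume "open S"
  show "g -` S \<inter> space M \<in> sets M"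
  proof (rule in_sets_AE)
    show "AE x in M. x \<in> f -` S \<inter> space M \<longleftrightarrow> x \<in> g -` S \<inter> space M"
      using eq by eventually_elim auto
    show "f -` S \<inter> space M \<in> sets M"
      using f \<open>open S\<close> by (auto intro: measurable_sets)
  qed auto
qed

lemma AE_measure_preserving:
  assumes "T \<in> measurable M M" and "distr M M T = M" and "AE x in M. P x"
  shows "AE x in M. P (T x)"
  using assms(3) by (intro AE_distrD[OF assms(1)]) (subst assms(2))

text \<open>A product measurable version of \<open>\<rho>\<close> has measurable sections. By Fubini
  almost every section of \<open>\<rho>\<close> agrees with such a section almost everywhere, and
  completeness of \<open>M\<close> makes it measurable.\<close>

lemma AE_section_measurable:
  fixes \<rho> :: "'x \<Rightarrow> 'x \<Rightarrow> real"
  assumes "sigma_finite_measure M" and "complete_measure M"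
    and \<rho>: "(\<lambda>(x, y). \<rho> x y) \<in> borel_measurable (completion (M \<Otimes>\<^sub>M M))"
  shows "AE x in M. (\<lambda>y. \<rho> x y) \<in> borel_measurable M"
proof -
  interpret M: complete_measure M by (rule assms(2))
  interpret P: pair_sigma_finite M M
    using assms(1) by (simp add: pair_sigma_finite_def)
  obtain g where g: "g \<in> borel_measurable (M \<Otimes>\<^sub>M M)" "AE z in M \<Otimes>\<^sub>M M. (case z of (x, y) \<Rightarrow> \<rho> x y) = g z"
    using completion_ex_borel_measurable_real[OF \<rho>] by blast
  have "AE x in M. AE y in M. \<rho> x y = g (x, y)"
    using P.AE_pair[OF g(2)] by simp
  moreover have "AE x in M. x \<in> space M" by (rule AE_space)
  ultimately show ?thesis
  proof eventually_elim
    case (elim x)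
    have "(\<lambda>y. g (x, y)) \<in> borel_measurable M" using g(1) elim(2) by simp
    moreover have "AE y in M. g (x, y) = \<rho> x y" using elim(1) by eventually_elim simp
    ultimately show ?case by (rule M.borel_measurable_AE_eq)
  qed
qed

text \<open>
  The graph of \<open>T\<close> is a null set of the product, so measurability on it is not automatic.
  Separability expresses \<open>\<rho> x y\<close> through the distances to countably many points with measurable
  sections.
\<close>

lemma admissible_measurable_on_graph:
  assumes "prob_space M" and "complete_measure M" and adm: "\<rho> \<in> admissible_semimetrics M"
    and T: "T \<in> measurable M M" and distr: "distr M M T = M"
  shows "(\<lambda>x. \<rho> x (T x)) \<in> borel_measurable M"
proof -
  interpret prob_space M by (rule assms(1))
  interpret M: complete_measure M by (rule assms(2))
  from adm obtain A where semi: "measurable_semimetric M \<rho>"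
    and A: "A \<subseteq> space M" "space M - A \<in> null_sets M" and "separable_on A \<rho>"
    unfolding admissible_semimetrics_def by blast
  then obtain D where "countable D \<and> D \<subseteq> A \<and> (\<forall>x\<in>A. \<forall>e>0. \<exists>d\<in>D. \<rho> x d < e)"
    unfolding separable_on_def by (elim exE)
  then have D: "countable D" "D \<subseteq> A" "\<And>x e. x \<in> A \<Longrightarrow> e > 0 \<Longrightarrow> \<exists>d\<in>D. \<rho> x d < e"
    by simp_all
  have nonneg: "0 \<le> \<rho> x y" and sym: "\<rho> x y = \<rho> y x" if "x \<in> space M" "y \<in> space M" for x y
    using semi that unfolding measurable_semimetric_def by blast+
  have tri: "\<rho> x z \<le> \<rho> x y + \<rho> y z" if "x \<in> space M" "y \<in> space M" "z \<in> space M" for x y z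
    using semi that unfolding measurable_semimetric_def by blast
  \<comment> \<open>Almost every point belongs to \<open>Y\<close>, but the points of
    \<open>D\<close> need not have measurable sections.\<close>
  define Y where "Y = {y \<in> A. (\<lambda>x. \<rho> y x) \<in> borel_measurable M}"
  have YA: "Y \<subseteq> A" and YM: "Y \<subseteq> space M" using A by (auto simp: Y_def)
  have "AE y in M. y \<in> A" using A AE_not_in[OF A(2)] by auto
  moreover have "AE y in M. (\<lambda>x. \<rho> y x) \<in> borel_measurable M"
    using semi by (intro AE_section_measurable assms sigma_finite_measure_axioms) (simp add: measurable_semimetric_def)
  ultimately have AE_Y: "AE y in M. y \<in> Y" by eventually_elim (simp add: Y_def)
  \<comment> \<open>Each \<open>d\<close> in \<open>D\<close> is approximated from \<open>Y\<close>
    at every scale where this is possible. If \<open>x\<close> in \<open>Y\<close> is close to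
    \<open>d\<close>, then \<open>x\<close> itself shows that the scale is possible, so the chosen
    points are dense in \<open>Y\<close>.\<close>
  define c where "c d n = (SOME y. y \<in> Y \<and> \<rho> y d < 1 / real (Suc n))" for d n
  define D' where "D' = (\<lambda>(d, n). c d n) ` {(d, n) \<in> D \<times> UNIV. \<exists>y\<in>Y. \<rho> y d < 1 / real (Suc n)}"
  have c: "c d n \<in> Y \<and> \<rho> (c d n) d < 1 / real (Suc n)" if "\<exists>y\<in>Y. \<rho> y d < 1 / real (Suc n)" for d n
    unfolding c_def by (rule someI_ex) (use that in blast)
  have "countable {(d, n) \<in> D \<times> UNIV. \<exists>y\<in>Y. \<rho> y d < 1 / real (Suc n)}"
    by (rule countable_subset[of _ "D \<times> (UNIV :: nat set)"]) (use D(1) in auto)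
  then have countable: "countable D'" unfolding D'_def by (rule countable_image)
  have D'Y: "D' \<subseteq> Y" using c by (auto simp: D'_def)
  have dense: "\<exists>d\<in>D'. \<rho> x d < e" if x: "x \<in> Y" and e: "e > 0" for x e
  proof -
    obtain n where n: "1 / real (Suc n) < e / 2" using e nat_approx_posE[of "e / 2"] by auto
    obtain d where d: "d \<in> D" "\<rho> x d < 1 / real (Suc n)" using D(3)[of x "1 / real (Suc n)"] x YA by auto
    then have ex: "\<exists>y\<in>Y. \<rho> y d < 1 / real (Suc n)" using x by blast
    then have cd: "c d n \<in> Y" "\<rho> (c d n) d < 1 / real (Suc n)" using c by auto
    have "d \<in> space M" using d(1) D(2) A(1) by auto
    then have "\<rho> x (c d n) \<le> \<rho> x d + \<rho> (c d n) d"
      using tri[of x d "c d n"] sym[of d "c d n"] x cd(1) YM by auto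
    also have "\<dots> < e" using d(2) cd(2) n by simp
    finally have "\<rho> x (c d n) < e" .
    moreover have "c d n \<in> D'" unfolding D'_def using d(1) ex by (intro image_eqI[of _ _ "(d, n)"]) auto
    ultimately show ?thesis by blast
  qed
  \<comment> \<open>The triangle inequality makes \<open>\<rho> x y\<close> a lower bound, and
    points \<open>d\<close> close to \<open>x\<close> approach it; the distance from
    \<open>d\<close> to \<open>x\<close> enters twice, hence \<open>e / 2\<close>.\<close>
  have INF: "(INF d\<in>D'. \<rho> d x + \<rho> d y) = \<rho> x y" if x: "x \<in> Y" and y: "y \<in> Y" for x y
  proof (rule cInf_eq)
    fix a assume "a \<in> (\<lambda>d. \<rho> d x + \<rho> d y) ` D'"
    then obtain d where "d \<in> D'" "a = \<rho> d x + \<rho> d y" by blast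
    then show "\<rho> x y \<le> a" using tri[of x d y] sym[of x d] D'Y YM x y by auto
  next
    fix b assume b: "\<And>a. a \<in> (\<lambda>d. \<rho> d x + \<rho> d y) ` D' \<Longrightarrow> b \<le> a"
    show "b \<le> \<rho> x y"
    proof (rule field_le_epsilon)
      fix e :: real assume "e > 0"
      then obtain d where d: "d \<in> D'" "\<rho> x d < e / 2" using dense[OF x, of "e / 2"] by auto
      then have *: "d \<in> space M" "x \<in> space M" "y \<in> space M" using D'Y YM x y by auto
      have "b \<le> \<rho> d x + \<rho> d y" using b d(1) by blast
      also have "\<dots> \<le> \<rho> x y + e" using d(2) tri[OF *(1-3)] sym[OF *(1,2)] by linarith
      finally show "b \<le> \<rho> x y + e" .
    qed
  qed
  have "AE x in M. T x \<in> Y"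
    using T distr AE_Y by (rule AE_measure_preserving)
  with AE_Y have AE: "AE x in M. (INF d\<in>D'. \<rho> d x + \<rho> d (T x)) = \<rho> x (T x)"
    by eventually_elim (rule INF)
  have "(\<lambda>x. INF d\<in>D'. \<rho> d x + \<rho> d (T x)) \<in> borel_measurable M"
  proof (intro borel_measurable_cINF_real countable borel_measurable_add)
    fix d assume "d \<in> D'"
    then show 1: "(\<lambda>x. \<rho> d x) \<in> borel_measurable M" using D'Y by (auto simp: Y_def)
    show "(\<lambda>x. \<rho> d (T x)) \<in> borel_measurable M" using measurable_compose[OF T 1] .
  qed
  from M.borel_measurable_AE_eq[OF this AE] show ?thesis .
qed

section \<open>Nonvanishing displacement for free actions\<close>

lemma (in pmp_semimetric) displacement_eq_0D:
  assumes "g \<in> carrier G" and "displacement g = 0"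
  shows "AE x in M. r x (\<alpha> g x) = 0"
proof -
  have "AE x in M. 0 \<le> r x (\<alpha> g x)" using assms(1) act_closed r_nonneg by (intro AE_I2) auto
  from integral_nonneg_eq_0_iff_AE[OF integrable_displacement[OF assms(1)] this] assms(2)
  show ?thesis by (simp add: displacement_def)
qed

text \<open>If all displacements vanished, so would those of the conjugates of \<open>g\<close>;
  then \<open>r (\<alpha> h x) (\<alpha> h (\<alpha> g x)) = 0\<close> for almost every
  \<open>x\<close>, simultaneously for the countably many \<open>h\<close>. The generating property
  would force \<open>\<alpha> g x = x\<close>, against freeness.\<close>

lemma (in pmp_semimetric) displacement_not_0:
  assumes countable: "countable (carrier G)" and g: "g \<in> carrier G" "g \<noteq> \<one>\<^bsub>G\<^esub>"
    and free: "free_action G M \<alpha>" and gen: "generating G M \<alpha> r"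
  shows "\<exists>h\<in>carrier G. displacement h \<noteq> 0"
proof (rule ccontr)
  obtain A where A: "A \<subseteq> space M" "space M - A \<in> null_sets M"
    "\<And>x y. x \<in> A \<Longrightarrow> y \<in> A \<Longrightarrow> x \<noteq> y \<Longrightarrow> \<exists>h\<in>carrier G. r (\<alpha> h x) (\<alpha> h y) > 0"
    using gen unfolding generating_def by blast
  assume "\<not> ?thesis"
  then have "AE x in M. r x (\<alpha> h x) = 0" if "h \<in> carrier G" for h
    using that displacement_eq_0D by blast
  then have "AE x in M. r (\<alpha> h x) (\<alpha> (h \<otimes>\<^bsub>G\<^esub> g \<otimes>\<^bsub>G\<^esub> inv\<^bsub>G\<^esub> h) (\<alpha> h x)) = 0" if "h \<in> carrier G" for h
    using that g(1) by (intro AE_measure_preserving[OF act_measurable[OF that] act_distr[OF that]]) simp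
  then have "AE x in M. \<forall>h\<in>carrier G. r (\<alpha> h x) (\<alpha> (h \<otimes>\<^bsub>G\<^esub> g \<otimes>\<^bsub>G\<^esub> inv\<^bsub>G\<^esub> h) (\<alpha> h x)) = 0"
    by (subst AE_ball_countable[OF countable]) (rule ballI)
  moreover have AE_A: "AE x in M. x \<in> A" using A AE_not_in[OF A(2)] by auto
  moreover have "AE x in M. \<alpha> g x \<in> A"
    using act_measurable[OF g(1)] act_distr[OF g(1)] AE_A by (rule AE_measure_preserving)
  moreover have "AE x in M. stabilizer G \<alpha> x = {\<one>\<^bsub>G\<^esub>}" using free by (simp add: free_action_def)
  ultimately have "AE x in M. False"
  proof eventually_elim
    case (elim x)
    have x: "x \<in> space M" using elim A by auto
    have "\<alpha> g x \<noteq> x"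
    proof
      assume "\<alpha> g x = x"
      then have "g \<in> stabilizer G \<alpha> x" using g by (simp add: stabilizer_def)
      with elim g show False by simp
    qed
    then obtain h where h: "h \<in> carrier G" "r (\<alpha> h x) (\<alpha> h (\<alpha> g x)) > 0" using A(3) elim by metis
    have "\<alpha> (h \<otimes>\<^bsub>G\<^esub> g \<otimes>\<^bsub>G\<^esub> inv\<^bsub>G\<^esub> h) (\<alpha> h x) = \<alpha> (h \<otimes>\<^bsub>G\<^esub> g \<otimes>\<^bsub>G\<^esub> inv\<^bsub>G\<^esub> h \<otimes>\<^bsub>G\<^esub> h) x"
      using h(1) g x composition_rule by simp
    also have "h \<otimes>\<^bsub>G\<^esub> g \<otimes>\<^bsub>G\<^esub> inv\<^bsub>G\<^esub> h \<otimes>\<^bsub>G\<^esub> h = h \<otimes>\<^bsub>G\<^esub> g"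
      using h(1) g by (simp add: m_assoc)
    also have "\<alpha> (h \<otimes>\<^bsub>G\<^esub> g) x = \<alpha> h (\<alpha> g x)"
      using h(1) g x composition_rule by simp
    finally show ?case using elim h by force
  qed
  then show False by simp
qed


section \<open>The growth gap\<close>

text \<open>Over a finite field, 1 plus the product of all \<open>X - a\<close> is a nonconstant
  polynomial without roots.\<close>

lemma infinite_alg_closed_field: "infinite (UNIV :: 'a::alg_closed_field set)"
proof
  assume fin: "finite (UNIV :: 'a set)"
  let ?p = "\<Prod>a\<in>(UNIV :: 'a set). [:- a, 1:]"
  have "Polynomial.degree ?p = card (UNIV :: 'a set)" by (subst degree_prod_eq_sum_degree) auto
  then have "Polynomial.degree ?p > 0" using fin by (simp add: card_gt_0_iff)
  then have "Polynomial.degree (?p + 1) > 0" by (subst degree_add_eq_left) auto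
  then obtain x where "poly (?p + 1) x = 0" using alg_closed_imp_poly_has_root by blast
  moreover have "poly ?p x = 0" using fin by (auto simp: poly_prod)
  ultimately show False by simp
qed

lemma card_increasing_exhaustion_at_top:
  assumes "infinite (UNIV :: 'a set)" and "\<And>n. finite (K n)" and "\<And>n. K n \<subseteq> K (Suc n)"
    and "(\<Union>n. K n) = (UNIV :: 'a set)"
  shows "filterlim (\<lambda>n. card (K n)) at_top sequentially"
proof -
  have mono: "mono K" using assms(3) by (intro incseq_SucI) auto
  show ?thesis unfolding filterlim_at_top
  proof
    fix N
    obtain F :: "'a set" where F: "finite F" "card F = N"
      using infinite_arbitrarily_large[OF assms(1)] by blast
    have "\<exists>n. F \<subseteq> K n" using F(1)
    proof induction
      case (insert a F)
      then obtain n m where "F \<subseteq> K n" "a \<in> K m" using assms(4) by blast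
      then show ?case using monoD[OF mono, of n "max n m"] monoD[OF mono, of m "max n m"]
        by (intro exI[of _ "max n m"]) auto
    qed simp
    then obtain n where n: "F \<subseteq> K n" by blast
    show "\<forall>\<^sub>F n in sequentially. N \<le> card (K n)"
      unfolding eventually_sequentially
    proof (intro exI allI impI)
      fix m assume "n \<le> m"
      then have "F \<subseteq> K m" using n monoD[OF mono] by blast
      then show "N \<le> card (K m)" using F(2) card_mono[OF assms(2)] by blast
    qed
  qed
qed

text \<open>Each \<open>g\<close> lies in all \<open>H n\<close> from some index on, where the
  translate by \<open>g\<close> equals \<open>H n\<close>; the quotients are eventually
  zero.\<close>

lemma folner_sequence_increasing_subgroups:
  fixes G (structure)
  assumes "group G" and H: "\<And>n. subgroup (H n) G" "\<And>n. finite (H n)" "\<And>n. H n \<subseteq> H (Suc n)"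
    and union: "carrier G = (\<Union>n. H n)"
  shows "folner_sequence G H"
  unfolding folner_sequence_def
proof (intro conjI allI ballI)
  interpret group G by (rule assms(1))
  fix n
  show "finite (H n)" "H n \<noteq> {}" "H n \<subseteq> carrier G"
    using H subgroup.one_closed[OF H(1)[of n]] subgroup.subset[OF H(1)[of n]] by auto
next
  interpret group G by (rule assms(1))
  have mono: "mono H" using H(3) by (intro incseq_SucI) auto
  fix g assume "g \<in> carrier G"
  then obtain m where m: "g \<in> H m" using union by blast
  have "\<forall>\<^sub>F n in sequentially. real (card (sym_diff (H n #> g) (H n))) / real (card (H n)) = 0"
    unfolding eventually_sequentially
  proof (intro exI allI impI)
    fix n assume "m \<le> n"
    then have "g \<in> H n" using m monoD[OF mono] by blast
    then have "H n #> g = H n" using subgroup.rcos_const[OF H(1) assms(1)] by blast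
    then show "real (card (sym_diff (H n #> g) (H n))) / real (card (H n)) = 0" by simp
  qed
  then show "(\<lambda>n. real (card (sym_diff (H n #> g) (H n))) / real (card (H n))) \<longlonglongrightarrow> 0"
    by (rule tendsto_eventually)
qed

lemma seq_precsim_trans:
  assumes "seq_precsim \<phi> \<psi>" and "seq_precsim \<psi> \<theta>"
  shows "seq_precsim \<phi> \<theta>"
proof -
  obtain C D where C: "C > 0" "\<forall>\<^sub>F n in sequentially. \<phi> n \<le> ereal C * \<psi> n"
    and D: "D > 0" "\<forall>\<^sub>F n in sequentially. \<psi> n \<le> ereal D * \<theta> n"
    using assms unfolding seq_precsim_def by blast
  have "\<forall>\<^sub>F n in sequentially. \<phi> n \<le> ereal (C * D) * \<theta> n"
    using C(2) D(2)
  proof eventually_elim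
    case (elim n)
    have "ereal C * \<psi> n \<le> ereal C * (ereal D * \<theta> n)"
      using elim(2) C(1) by (intro ereal_mult_left_mono) auto
    also have "\<dots> = ereal (C * D) * \<theta> n" by (simp add: mult.assoc[symmetric])
    finally show ?case using elim(1) by simp
  qed
  then show ?thesis unfolding seq_precsim_def using C(1) D(1) by (intro exI[of _ "C * D"]) auto
qed

text \<open>Since \<open>ln 2 \<le> 1\<close>, small entropy yields \<open>k ^ 4 < q\<close>. For
  \<open>k > 17\<close> the fourth power dominates \<open>16 * k ^ 3 + 1\<close>; for
  \<open>k \<le> 17\<close> the lower bound on \<open>q\<close> takes over.\<close>

lemma entropy_partition_of_eps_entropy_less:
  assumes "ereal 4 * eps_entropy M \<rho> \<epsilon> < ereal (ln q)" and q: "q > 16 * 17 ^ 3 + 1"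
  shows "\<exists>k\<ge>1. entropy_partition M \<rho> \<epsilon> k \<and> real (16 * k ^ 3 + 1) < q"
proof -
  have "eps_entropy M \<rho> \<epsilon> < ereal (ln q / 4)"
    using assms(1) by (cases "eps_entropy M \<rho> \<epsilon>") auto
  then obtain k where k: "k \<ge> 1" "entropy_partition M \<rho> \<epsilon> k" "log 2 (real k) < ln q / 4"
    unfolding eps_entropy_def INF_less_iff by auto
  have "ln (real k) \<le> log 2 (real k)"
    using k(1) ln_le_minus_one[of 2] by (simp add: log_def le_divide_eq_1 field_simps mult_left_le)
  with k(3) have "4 * ln (real k) < ln q" by simp
  then have "ln (real k ^ 4) < ln q" using k(1) by (simp add: ln_realpow)
  then have k4: "real k ^ 4 < q" using k(1) q by simp
  have "real (16 * k ^ 3 + 1) < q"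
  proof (cases "k \<le> 17")
    case True
    then have "k ^ 3 \<le> 17 ^ 3" by (rule power_mono) simp
    then have "real (16 * k ^ 3 + 1) \<le> real (16 * 17 ^ 3 + 1)" by (intro of_nat_mono) simp
    with q show ?thesis by simp
  next
    case False
    then have "17 * k ^ 3 \<le> k ^ 4" by (simp add: power4_eq_xxxx power3_eq_cube)
    moreover have "1 \<le> k ^ 3" using k(1) by simp
    ultimately have "16 * k ^ 3 + 1 \<le> k ^ 4" by linarith
    then have "real (16 * k ^ 3 + 1) \<le> real (k ^ 4)" by (rule of_nat_mono)
    with k4 show ?thesis by simp
  qed
  with k show ?thesis by blast
qed

section \<open>Exhaustion of SL(2) by finite subgroups over growing subfields\<close>

context
  fixes K :: "nat \<Rightarrow> 'k::field set"
  assumes subfield: "\<And>n. finite_subfield (K n)"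
    and K_Suc: "\<And>n. K n \<subseteq> K (Suc n)"
    and infinite_field: "infinite (UNIV :: 'k set)"
    and exhaust: "carrier (SL2 (UNIV :: 'k set)) = (\<Union>n. carrier (SL2 (K n)))"
begin

lemma mono_SL2: "mono (\<lambda>n. carrier (SL2 (K n)))"
proof (rule incseq_SucI)
  show "carrier (SL2 (K n)) \<subseteq> carrier (SL2 (K (Suc n)))" for n using K_Suc[of n] by (auto simp: SL2_def)
qed

lemma folner_SL2: "folner_sequence (SL2 (UNIV :: 'k set)) (\<lambda>n. carrier (SL2 (K n)))"
proof (rule folner_sequence_increasing_subgroups[OF group_SL2])
  show "subgroup (carrier (SL2 (K n))) (SL2 UNIV)" for n
    using subfield by (rule finite_subfield.subgroup_SL2)
  show "finite (carrier (SL2 (K n)))" for n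
    using finite_subfield.finite_K[OF subfield] by (rule finite_carrier_SL2)
  show "carrier (SL2 (K n)) \<subseteq> carrier (SL2 (K (Suc n)))" for n
    using mono_SL2 by (rule incseq_SucD)
qed (rule exhaust)

lemma card_K_at_top: "filterlim (\<lambda>n. card (K n)) at_top sequentially"
proof (rule card_increasing_exhaustion_at_top[where K = K, OF infinite_field _ K_Suc])
  show "finite (K n)" for n using finite_subfield.finite_K[OF subfield] .
  \<comment> \<open>An exhaustion of the group exhausts the field, because every \<open>a\<close> is
    an entry of a unipotent.\<close>
  have "mat2 1 a 0 1 \<in> (\<Union>n. carrier (SL2 (K n)))" for a
    unfolding exhaust[symmetric] by (simp add: mat2_in_SL2_iff)
  then show "(\<Union>n. K n) = UNIV" by (auto simp: mat2_in_SL2_iff)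
qed

text \<open>Otherwise, for each \<open>\<delta>\<close>, infinitely many \<open>n\<close> have too
  small an entropy. A fixed group element lies in all late subgroups, so its displacement is at most
  \<open>44 * \<delta>\<close> for every \<open>\<delta>\<close> and vanishes.\<close>

lemma entropy_lower_bound:
  fixes M :: "'x measure" and \<rho>
  assumes M: "lebesgue_space M" and act: "pmp_action (SL2 UNIV) M \<alpha>" and free: "free_action (SL2 UNIV) M \<alpha>"
    and adm: "\<rho> \<in> admissible_semimetrics M" and gen: "generating (SL2 UNIV) M \<alpha> \<rho>"
  shows "\<exists>\<delta>>0. seq_precsim (\<lambda>n. ereal (ln (real (card (K n)))))
    (\<lambda>n. entropy_function M \<alpha> (\<lambda>n. carrier (SL2 (K n))) \<rho> n \<delta>)"
proof (rule ccontr)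
  assume no_gap: "\<not> ?thesis"
  let ?G = "SL2 (UNIV :: 'k set)"
  let ?H = "\<lambda>n. carrier (SL2 (K n))"
  \<comment> \<open>Truncation gives the bound 1 and keeps the triangle inequality, the entropy
    partitions and the pairs at positive distance, so \<open>r\<close> is still generating.\<close>
  define r where "r x y = min 1 (\<rho> x y)" for x y
  interpret prob_space M using M by (simp add: lebesgue_space_def)
  interpret group_action ?G "space M" \<alpha> using act by (simp add: pmp_action_def)
  have act': "\<alpha> g \<in> measurable M M" "distr M M (\<alpha> g) = M" if "g \<in> carrier ?G" for g
    using act that by (auto simp: pmp_action_def)
  have semi: "measurable_semimetric M \<rho>" using adm by (simp add: admissible_semimetrics_def)
  have nonneg: "0 \<le> \<rho> x y" if "x \<in> space M" "y \<in> space M" for x y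
    using semi that unfolding measurable_semimetric_def by blast
  have tri: "\<rho> x z \<le> \<rho> x y + \<rho> y z" if "x \<in> space M" "y \<in> space M" "z \<in> space M" for x y z
    using semi that unfolding measurable_semimetric_def by blast
  interpret pmp_semimetric M ?G \<alpha> r
  proof
    fix x y z assume "x \<in> space M" "y \<in> space M" "z \<in> space M"
    then show "r x z \<le> r x y + r y z"
      using tri[of x y z] nonneg[of x y] nonneg[of y z] by (auto simp: r_def min_def)
  next
    fix g assume g: "g \<in> carrier ?G"
    have "complete_measure M" using M by (simp add: lebesgue_space_def)
    from admissible_measurable_on_graph[OF prob_space_axioms this adm act'[OF g]]
    show "(\<lambda>x. r x (\<alpha> g x)) \<in> borel_measurable M" unfolding r_def by simp
  next
    fix x y assume "x \<in> space M" "y \<in> space M"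
    then show "0 \<le> r x y" "r x y \<le> 1" using nonneg[of x y] by (simp_all add: r_def)
  qed (rule act', assumption)+
  have part: "entropy_partition M (averaged_semimetric \<alpha> (?H n) r) \<delta> k"
    if "entropy_partition M (averaged_semimetric \<alpha> (?H n) \<rho>) \<delta> k" for n \<delta> k
    using that
    by (rule entropy_partition_mono) (auto simp: averaged_semimetric_def r_def intro!: divide_right_mono sum_mono)
  have displ: "displacement A \<le> 44 * \<delta>" if \<delta>: "\<delta> > 0" and A: "A \<in> carrier ?G" for \<delta> A
  proof -
    obtain m where m: "A \<in> ?H m" using A exhaust by blast
    \<comment> \<open>Among the constants excluded by \<open>no_gap\<close>, 4 is the one that turns
      entropy into a fourth power of \<open>k\<close>.\<close>
    have "\<exists>\<^sub>F n in sequentially. \<not> ereal (ln (real (card (K n)))) \<le> ereal 4 * entropy_function M \<alpha> ?H \<rho> n \<delta>"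
    proof (rule ccontr)
      assume "\<not> ?thesis"
      then have "seq_precsim (\<lambda>n. ereal (ln (real (card (K n))))) (\<lambda>n. entropy_function M \<alpha> ?H \<rho> n \<delta>)"
        unfolding seq_precsim_def not_frequently not_not by (intro exI[of _ 4] conjI) simp_all
      with no_gap \<delta> show False by blast
    qed
    moreover have "\<forall>\<^sub>F n in sequentially. m \<le> n \<and> 16 * 17 ^ 3 + 2 \<le> card (K n)"
      using card_K_at_top by (intro eventually_conj eventually_ge_at_top) (simp add: filterlim_at_top)
    ultimately have "\<exists>\<^sub>F n in sequentially.
      \<not> ereal (ln (real (card (K n)))) \<le> ereal 4 * entropy_function M \<alpha> ?H \<rho> n \<delta> \<and>
      m \<le> n \<and> 16 * 17 ^ 3 + 2 \<le> card (K n)"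
      by (rule frequently_rev_mp[OF _ eventually_mono]) auto
    then obtain n where n: "ereal 4 * eps_entropy M (averaged_semimetric \<alpha> (?H n) \<rho>) \<delta> < ereal (ln (real (card (K n))))"
      "m \<le> n" "16 * 17 ^ 3 + 2 \<le> card (K n)"
      by (auto simp: entropy_function_def not_le dest: frequently_ex)
    have "real (16 * 17 ^ 3 + 2) \<le> real (card (K n))" using n(3) by (rule of_nat_mono)
    then have "real (card (K n)) > 16 * 17 ^ 3 + 1" by simp
    from entropy_partition_of_eps_entropy_less[OF n(1) this]
    obtain k where k: "k \<ge> 1" "entropy_partition M (averaged_semimetric \<alpha> (?H n) \<rho>) \<delta> k"
      "16 * k ^ 3 + 1 < card (K n)" by (auto simp only: of_nat_less_iff)
    interpret K: finite_subfield "K n" by (rule subfield)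
    interpret S: SL2_semimetric M \<alpha> r "K n" ..
    have "A \<in> ?H n" using m monoD[OF mono_SL2 n(2)] by auto
    from S.displacement_le_of_entropy_partition[OF k(1,3) part[OF k(2)] this] show ?thesis .
  qed
  have "displacement A = 0" if A: "A \<in> carrier ?G" for A
  proof (rule antisym)
    show "displacement A \<le> 0"
    proof (rule field_le_epsilon)
      fix e :: real assume "e > 0"
      then show "displacement A \<le> 0 + e" using displ[of "e / 44" A] A by simp
    qed
  qed (rule displacement_nonneg[OF A])
  moreover have "\<exists>A\<in>carrier ?G. displacement A \<noteq> 0"
  proof (rule displacement_not_0)
    have "countable (?H n)" for n
      using finite_carrier_SL2[OF finite_subfield.finite_K[OF subfield]] by (rule countable_finite)
    then show "countable (carrier ?G)" unfolding exhaust by blast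
    show "mat2 1 1 0 1 \<in> carrier ?G" by (simp add: mat2_in_SL2_iff)
    show "mat2 1 1 0 1 \<noteq> \<one>\<^bsub>?G\<^esub>" by (simp add: one_SL2 mat_1_eq_mat2 mat2_inject)
    show "free_action ?G M \<alpha>" by (rule free)
    have "(r x y > 0) = (\<rho> x y > 0)" for x y by (simp add: r_def)
    then show "generating ?G M \<alpha> r" using gen unfolding generating_def by simp
  qed
  ultimately show False by blast
qed

text \<open>A member of the scaling entropy dominates the entropy function of some generating
  semimetric, and the lower bound passes along.\<close>

lemma scaling_entropy_growth_gap_SL2:
  "scaling_entropy_growth_gap TYPE('x) (SL2 (UNIV :: 'k set))
     (\<lambda>n. carrier (SL2 (K n))) (\<lambda>n. ln (real (card (K n))))"
  unfolding scaling_entropy_growth_gap_def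
proof (intro conjI allI impI ballI)
  show "filterlim (\<lambda>n. ln (real (card (K n)))) at_top sequentially"
    by (intro filterlim_compose[OF ln_at_top] filterlim_compose[OF filterlim_real_sequentially] card_K_at_top)
next
  fix M :: "'x measure" and \<alpha> \<Phi>
  let ?E = "\<lambda>\<rho>. entropy_function M \<alpha> (\<lambda>n. carrier (SL2 (K n))) \<rho>"
  assume *: "lebesgue_space M \<and> pmp_action (SL2 UNIV) M \<alpha> \<and> free_action (SL2 UNIV) M \<alpha>"
    and "\<Phi> \<in> scaling_entropy (SL2 UNIV) M \<alpha> (\<lambda>n. carrier (SL2 (K n)))"
  then obtain \<rho> where \<rho>: "\<rho> \<in> admissible_semimetrics M" "generating (SL2 UNIV) M \<alpha> \<rho>" "?E \<rho> \<lesssim> \<Phi>"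
    unfolding scaling_entropy_def by blast
  from entropy_lower_bound[OF _ _ _ \<rho>(1,2)] * obtain \<delta> where \<delta>: "\<delta> > 0"
    "seq_precsim (\<lambda>n. ereal (ln (real (card (K n))))) (\<lambda>n. ?E \<rho> n \<delta>)" by blast
  moreover obtain \<epsilon> where "\<epsilon> > 0" "seq_precsim (\<lambda>n. ?E \<rho> n \<delta>) (\<lambda>n. \<Phi> n \<epsilon>)"
    using \<rho>(3) \<delta>(1) unfolding precsim_def by blast
  ultimately show "(\<lambda>n \<epsilon>. ereal (ln (real (card (K n))))) \<lesssim> \<Phi>"
    unfolding precsim_def using seq_precsim_trans by blast
qed

end

theorem theorem14:
  fixes p :: nat
    and K :: "nat \<Rightarrow> 'f::field alg_closure set"
    and q :: "nat \<Rightarrow> nat"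
  assumes "Factorial_Ring.prime p" and "p > 2" and "CARD('f) = p"
    and "\<And>n. subfield (K n) (ring_of_type_algebra :: 'f alg_closure ring)"
    and "\<And>n. finite (K n)" and "\<And>n. q n = card (K n)"
    and "\<And>n. K n \<subseteq> K (Suc n)"
    and "carrier (SL2 (UNIV :: 'f alg_closure set)) = (\<Union>n. carrier (SL2 (K n)))"
  shows "folner_sequence (SL2 (UNIV :: 'f alg_closure set)) (\<lambda>n. carrier (SL2 (K n))) \<and>
         scaling_entropy_growth_gap TYPE('x) (SL2 (UNIV :: 'f alg_closure set))
           (\<lambda>n. carrier (SL2 (K n))) (\<lambda>n. ln (real (q n)))"
proof -
  have K: "finite_subfield (K n)" for n using assms(4,5) by (rule finite_subfieldI)
  have "folner_sequence (SL2 (UNIV :: 'f alg_closure set)) (\<lambda>n. carrier (SL2 (K n)))"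
    by (rule folner_SL2[OF K assms(7) infinite_alg_closed_field assms(8)])
  moreover have "scaling_entropy_growth_gap TYPE('x) (SL2 (UNIV :: 'f alg_closure set))
    (\<lambda>n. carrier (SL2 (K n))) (\<lambda>n. ln (real (card (K n))))"
    by (rule scaling_entropy_growth_gap_SL2[OF K assms(7) infinite_alg_closed_field assms(8)])
  ultimately show ?thesis by (simp add: assms(6))
qed

end
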